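(* Let $(a,b,c,d)\in P$. Then the (densely defined, unbounded) operator $(L,\mathcal D)$ on the Hilbert space $\mathcal L^2$ is self-adjoint.
   Context: Fix $q\in(0,1)$, $z_+>0$, $z_-<0$. $(x;q)_\infty=\prod_{k\ge0}(1-xq^k)$, $(x,y;q)_\infty=(x;q)_\infty(y;q)_\infty$. $\mathbb R_q^{\pm}=\{z_\pm q^n:n\in\mathbb Z\}$, $\mathbb R_q=\mathbb R_q^-\cup\mathbb R_q^+$. Parameters: $P_{q,z_-,z_+}$ is the set of $(\alpha,\beta)\in(\mathbb C\setminus\{0\})^2$ with $\alpha,\beta\notin z_+^{-1}q^{\mathbb Z}\cup z_-^{-1}q^{\mathbb Z}$ and one of: (i) $\alpha=\overline\beta$; (ii) $\alpha,\beta$ real and $z_+q^{k_0}<\beta^{-1}<\alpha^{-1}<z_+q^{k_0-1}$ for some $k_0\in\mathbb Z$; (iii) $\alpha,\beta$ real and $z_-q^{k_0-1}<\alpha^{-1}<\beta^{-1}<z_-q^{k_0}$ for some $k_0\in\mathbb Z$. $P=\{(a,b,c,d): (a,b),(c,d)\in P_{q,z_-,z_+},\ a\ne b\}$. $s=\sqrt{cdq/ab}>0$ (note $ab,cd>0$). Operator: $(Lf)(x)=A(x)f(x/q)+B(x)f(qx)+C(x)f(x)$ for $f:\mathbb R_q\to\mathbb C$, where $A(x)=s^{-1}(1-\frac q{ax})(1-\frac q{bx})$, $B(x)=s(1-\frac1{cx})(1-\frac1{dx})$, $C=s^{-1}+s-A-B$. Space: $w(x)=\frac{(ax,bx;q)_\infty}{(cx,dx;q)_\infty}$,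 which is positive on $\mathbb R_q$. $\int_{\mathbb R_q}f\,d_qx=(1-q)\sum_{n\in\mathbb Z}\big(f(z_+q^n)z_+q^n-f(z_-q^n)z_-q^n\big)$. $\mathcal L^2$ is the Hilbert space of $f:\mathbb R_q\to\mathbb C$ of finite norm with respect to $\langle f,g\rangle_{\mathcal L^2}=\int_{\mathbb R_q}f\bar g\,w\,d_qx$. Domain: $(D_qf)(x)=\frac{f(x)-f(qx)}{(1-q)x}$, $f(0^\pm)=\lim_{k\to\infty}f(z_\pm q^k)$, $f'(0^\pm)=\lim_{k\to\infty}(D_qf)(z_\pm q^k)$. $\mathcal D=\{f\in\mathcal L^2: Lf\in\mathcal L^2,\ f(0^-)=f(0^+),\ f'(0^-)=f'(0^+)\}$, where all four limits are required to exist. *)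

theory Defs
  imports "HOL-Analysis.Analysis"
begin

text \<open>In the operator-theoretic definitions, the Hilbert space is given by its carrier \<open>H\<close>, a set of functions with pointwise linear
  structure, and its inner product \<open>ip\<close>, linear in the first argument.\<close>

definition csubspace_in :: "('x \<Rightarrow> complex) set \<Rightarrow> ('x \<Rightarrow> complex) set \<Rightarrow> bool" where
  "csubspace_in H D \<longleftrightarrow> D \<subseteq> H \<and> (\<lambda>_. 0) \<in> D \<and>
     (\<forall>f\<in>D. \<forall>g\<in>D. \<forall>r t. (\<lambda>x. r * f x + t * g x) \<in> D)"

definition clinear_operator_on ::
    "('x \<Rightarrow> complex) set \<Rightarrow> (('x \<Rightarrow> complex) \<Rightarrow> ('x \<Rightarrow> complex)) \<Rightarrow> ('x \<Rightarrow> complex) set \<Rightarrow> bool" where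
  "clinear_operator_on H T D \<longleftrightarrow> csubspace_in H D \<and> T ` D \<subseteq> H \<and>
     (\<forall>f\<in>D. \<forall>g\<in>D. \<forall>r t. T (\<lambda>x. r * f x + t * g x) = (\<lambda>x. r * T f x + t * T g x))"

definition ip_norm ::
    "(('x \<Rightarrow> complex) \<Rightarrow> ('x \<Rightarrow> complex) \<Rightarrow> complex) \<Rightarrow> ('x \<Rightarrow> complex) \<Rightarrow> real" where
  "ip_norm ip f = sqrt (Re (ip f f))"

definition dense_in ::
    "('x \<Rightarrow> complex) set \<Rightarrow> (('x \<Rightarrow> complex) \<Rightarrow> ('x \<Rightarrow> complex) \<Rightarrow> complex) \<Rightarrow>
     ('x \<Rightarrow> complex) set \<Rightarrow> bool" where
  "dense_in H ip D \<longleftrightarrow> (\<forall>f\<in>H. \<forall>e>0. \<exists>g\<in>D. ip_norm ip (\<lambda>x. f x - g x) < e)"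

definition operator_graph ::
    "(('x \<Rightarrow> complex) \<Rightarrow> ('x \<Rightarrow> complex)) \<Rightarrow> ('x \<Rightarrow> complex) set \<Rightarrow>
     (('x \<Rightarrow> complex) \<times> ('x \<Rightarrow> complex)) set" where
  "operator_graph T D = {(f, T f) | f. f \<in> D}"

definition adjoint_graph ::
    "('x \<Rightarrow> complex) set \<Rightarrow> (('x \<Rightarrow> complex) \<Rightarrow> ('x \<Rightarrow> complex) \<Rightarrow> complex) \<Rightarrow>
     (('x \<Rightarrow> complex) \<Rightarrow> ('x \<Rightarrow> complex)) \<Rightarrow> ('x \<Rightarrow> complex) set \<Rightarrow>
     (('x \<Rightarrow> complex) \<times> ('x \<Rightarrow> complex)) set" where
  "adjoint_graph H ip T D = {(g, h). g \<in> H \<and> h \<in> H \<and> (\<forall>f\<in>D. ip (T f) g = ip f h)}"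

text \<open>Equality of the graphs says that \<open>T\<close> and its adjoint have the same domain and the same
  values there.\<close>

definition self_adjoint_operator ::
    "('x \<Rightarrow> complex) set \<Rightarrow> (('x \<Rightarrow> complex) \<Rightarrow> ('x \<Rightarrow> complex) \<Rightarrow> complex) \<Rightarrow>
     (('x \<Rightarrow> complex) \<Rightarrow> ('x \<Rightarrow> complex)) \<Rightarrow> ('x \<Rightarrow> complex) set \<Rightarrow> bool" where
  "self_adjoint_operator H ip T D \<longleftrightarrow>
     clinear_operator_on H T D \<and> dense_in H ip D \<and>
     adjoint_graph H ip T D = operator_graph T D"

text \<open>Below, \<open>zm\<close> and \<open>zp\<close> stand for $z_- < 0$ and $z_+ > 0$.\<close>

definition q_half_line :: "real \<Rightarrow> real \<Rightarrow> real set" where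
  "q_half_line q z = {z * q powi n | n :: int. True}"

definition q_line :: "real \<Rightarrow> real \<Rightarrow> real \<Rightarrow> real set" where
  "q_line q zm zp = q_half_line q zm \<union> q_half_line q zp"

definition qpoch_inf :: "real \<Rightarrow> complex \<Rightarrow> complex" where
  "qpoch_inf q x = (\<Prod>k. 1 - x * of_real q ^ k)"

definition jackson_term :: "real \<Rightarrow> real \<Rightarrow> real \<Rightarrow> (real \<Rightarrow> complex) \<Rightarrow> int \<Rightarrow> complex" where
  "jackson_term q zm zp f n =
     f (zp * q powi n) * of_real (zp * q powi n) - f (zm * q powi n) * of_real (zm * q powi n)"

text \<open>Sums over the integers are unconditional. Since \<open>infsum\<close> returns 0 on divergent families,
  finiteness of the norm is stated through \<open>jackson_integrable\<close>.\<close>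

definition jackson_integrable :: "real \<Rightarrow> real \<Rightarrow> real \<Rightarrow> (real \<Rightarrow> complex) \<Rightarrow> bool" where
  "jackson_integrable q zm zp f \<longleftrightarrow> jackson_term q zm zp f summable_on UNIV"

definition jackson_integral :: "real \<Rightarrow> real \<Rightarrow> real \<Rightarrow> (real \<Rightarrow> complex) \<Rightarrow> complex" where
  "jackson_integral q zm zp f = of_real (1 - q) * (\<Sum>\<^sub>\<infinity>n. jackson_term q zm zp f n)"

definition param_pairs :: "real \<Rightarrow> real \<Rightarrow> real \<Rightarrow> (complex \<times> complex) set" where
  "param_pairs q zm zp = {(\<alpha>, \<beta>).
     \<alpha> \<noteq> 0 \<and> \<beta> \<noteq> 0 \<and>
     \<alpha> \<notin> of_real ` (q_half_line q (inverse zp) \<union> q_half_line q (inverse zm)) \<and>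
     \<beta> \<notin> of_real ` (q_half_line q (inverse zp) \<union> q_half_line q (inverse zm)) \<and>
     (\<alpha> = cnj \<beta> \<or>
      (\<exists>r t :: real. \<alpha> = of_real r \<and> \<beta> = of_real t \<and>
        (\<exists>k0 :: int. zp * q powi k0 < inverse t \<and> inverse t < inverse r \<and>
                     inverse r < zp * q powi (k0 - 1))) \<or>
      (\<exists>r t :: real. \<alpha> = of_real r \<and> \<beta> = of_real t \<and>
        (\<exists>k0 :: int. zm * q powi (k0 - 1) < inverse r \<and> inverse r < inverse t \<and>
                     inverse t < zm * q powi k0)))}"

definition param_set :: "real \<Rightarrow> real \<Rightarrow> real \<Rightarrow> (complex \<times> complex \<times> complex \<times> complex) set" where
  "param_set q zm zp =
     {(a, b, c, d). (a, b) \<in> param_pairs q zm zp \<and> (c, d) \<in> param_pairs q zm zp \<and> a \<noteq> b}"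

text \<open>On \<open>param_set\<close> the radicand is a positive real, so its principal complex square root
  is the positive one.\<close>

definition s_param :: "real \<Rightarrow> complex \<Rightarrow> complex \<Rightarrow> complex \<Rightarrow> complex \<Rightarrow> complex" where
  "s_param q a b c d = csqrt (c * d * of_real q / (a * b))"

definition weight :: "real \<Rightarrow> complex \<Rightarrow> complex \<Rightarrow> complex \<Rightarrow> complex \<Rightarrow> real \<Rightarrow> complex" where
  "weight q a b c d x =
     (qpoch_inf q (a * of_real x) * qpoch_inf q (b * of_real x)) /
     (qpoch_inf q (c * of_real x) * qpoch_inf q (d * of_real x))"

definition L2_inner :: "real \<Rightarrow> real \<Rightarrow> real \<Rightarrow> complex \<Rightarrow> complex \<Rightarrow> complex \<Rightarrow> complex \<Rightarrow>
    (real \<Rightarrow> complex) \<Rightarrow> (real \<Rightarrow> complex) \<Rightarrow> complex" where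
  "L2_inner q zm zp a b c d f g =
     jackson_integral q zm zp (\<lambda>x. f x * cnj (g x) * weight q a b c d x)"

text \<open>A function on \<open>q_line\<close> is represented by its extension by zero to the reals, so that
  functions agreeing on \<open>q_line\<close> are equal.\<close>

definition L2_space :: "real \<Rightarrow> real \<Rightarrow> real \<Rightarrow> complex \<Rightarrow> complex \<Rightarrow> complex \<Rightarrow> complex \<Rightarrow>
    (real \<Rightarrow> complex) set" where
  "L2_space q zm zp a b c d =
     {f. (\<forall>x. x \<notin> q_line q zm zp \<longrightarrow> f x = 0) \<and>
         jackson_integrable q zm zp (\<lambda>x. f x * cnj (f x) * weight q a b c d x)}"

definition coeff_A :: "real \<Rightarrow> complex \<Rightarrow> complex \<Rightarrow> complex \<Rightarrow> complex \<Rightarrow> real \<Rightarrow> complex" where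
  "coeff_A q a b c d x = inverse (s_param q a b c d) *
     (1 - of_real q / (a * of_real x)) * (1 - of_real q / (b * of_real x))"

definition coeff_B :: "real \<Rightarrow> complex \<Rightarrow> complex \<Rightarrow> complex \<Rightarrow> complex \<Rightarrow> real \<Rightarrow> complex" where
  "coeff_B q a b c d x = s_param q a b c d *
     (1 - 1 / (c * of_real x)) * (1 - 1 / (d * of_real x))"

definition coeff_C :: "real \<Rightarrow> complex \<Rightarrow> complex \<Rightarrow> complex \<Rightarrow> complex \<Rightarrow> real \<Rightarrow> complex" where
  "coeff_C q a b c d x = inverse (s_param q a b c d) + s_param q a b c d
     - coeff_A q a b c d x - coeff_B q a b c d x"

definition L_op :: "real \<Rightarrow> real \<Rightarrow> real \<Rightarrow> complex \<Rightarrow> complex \<Rightarrow> complex \<Rightarrow> complex \<Rightarrow>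
    (real \<Rightarrow> complex) \<Rightarrow> (real \<Rightarrow> complex)" where
  "L_op q zm zp a b c d f = (\<lambda>x. if x \<in> q_line q zm zp
     then coeff_A q a b c d x * f (x / q) + coeff_B q a b c d x * f (q * x)
          + coeff_C q a b c d x * f x
     else 0)"

definition Dq :: "real \<Rightarrow> (real \<Rightarrow> complex) \<Rightarrow> real \<Rightarrow> complex" where
  "Dq q f x = (f x - f (q * x)) / of_real ((1 - q) * x)"

definition L_domain :: "real \<Rightarrow> real \<Rightarrow> real \<Rightarrow> complex \<Rightarrow> complex \<Rightarrow> complex \<Rightarrow> complex \<Rightarrow>
    (real \<Rightarrow> complex) set" where
  "L_domain q zm zp a b c d =
     {f \<in> L2_space q zm zp a b c d.
        L_op q zm zp a b c d f \<in> L2_space q zm zp a b c d \<and>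
        (\<exists>l. (\<lambda>k. f (zm * q ^ k)) \<longlonglongrightarrow> l \<and> (\<lambda>k. f (zp * q ^ k)) \<longlonglongrightarrow> l) \<and>
        (\<exists>l. (\<lambda>k. Dq q f (zm * q ^ k)) \<longlonglongrightarrow> l \<and> (\<lambda>k. Dq q f (zp * q ^ k)) \<longlonglongrightarrow> l)}"

end

theory Submission
  imports Defs
begin

text \<open>On each branch \<open>z q\<^sup>n\<close> the weight symmetrizes \<open>L\<close> into a doubly infinite Jacobi operator
  with weight \<open>W n = w(x) \<bar>x\<bar>\<close> and conductance \<open>p n = A(x) W n\<close>. Towards infinity \<open>p\<close> is
  dominated by \<open>W\<close>, so the boundary term of Green's formula vanishes there; towards 0 both
  \<open>W\<close> and \<open>1/p\<close> are summable, so every \<open>f\<close> with \<open>f\<close> and \<open>L f\<close> square summable has a limit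
  value and a limit flux, the flux being a multiple of \<open>D\<^sub>q f\<close>. The domain glues the two
  branches along these boundary values, which is a Lagrangian condition for the boundary form.\<close>

subsection \<open>Jacobi operators on the integers\<close>

text \<open>In \<open>x = z * q powi n\<close> increasing \<open>n\<close> moves towards the origin,
  so \<open>n\<close> to +infinity is the end where boundary values live and \<open>n\<close> to
  -infinity is the end at infinity. Near the origin \<open>w\<close> tends to 1 while
  \<open>A\<close> has a double pole, so \<open>W\<close> behaves like |x| and \<open>p\<close> like
  a constant over |x|; both \<open>W\<close> and \<open>1 / p\<close> therefore decay geometrically.
  Each branch thus contributes two boundary values, four in all, and the domain imposes two linear
  conditions on them. Symmetry only needs these conditions to cancel the boundary form; the harder
  half is maximality, that every element of the adjoint domain satisfies both of them. Point masses
  first determine how the adjoint acts. Then two test functions in the domain, one with value 1 and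
  flux 0, the other with value 0 and flux of modulus 1, isolate the flux condition and the value
  condition. The bounds \<open>p_le\<close> and \<open>p_le'\<close> encode that
  \<open>A = p n / W n\<close> and \<open>B = p (n + 1) / W n\<close> stay bounded for large
  |x|.\<close>

locale jacobi =
  fixes W p :: "int \<Rightarrow> real" and \<mu> K :: real
  assumes W_pos: "W n > 0" and p_pos: "p n > 0"
    and W_summable: "summable (\<lambda>k. W (int k))"
    and p_summable: "summable (\<lambda>k. 1 / p (int k))"
    and p_le: "n \<le> 0 \<Longrightarrow> p n \<le> K * W n"
    and p_le': "n \<le> 0 \<Longrightarrow> p (n + 1) \<le> K * W n"
begin

definition ell2 :: "(int \<Rightarrow> complex) set" where
  "ell2 = {F. (\<lambda>n. (norm (F n))\<^sup>2 * W n) summable_on UNIV}"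

definition pairing :: "(int \<Rightarrow> complex) \<Rightarrow> (int \<Rightarrow> complex) \<Rightarrow> complex" where
  "pairing F G = (\<Sum>\<^sub>\<infinity>n. F n * cnj (G n) * of_real (W n))"

text \<open>The quasi-derivative of the Sturm-Liouville form of the operator. The difference points
  towards \<open>n - 1\<close>, so the increment of the flux from \<open>n\<close> to
  \<open>n + 1\<close> involves \<open>p n\<close> and \<open>p (n + 1)\<close>, which after
  division by \<open>W n\<close> become the coefficients \<open>A\<close> and
  \<open>B\<close>.\<close>

definition flux :: "(int \<Rightarrow> complex) \<Rightarrow> int \<Rightarrow> complex" where
  "flux F n = of_real (p n) * (F (n - 1) - F n)"

definition jac :: "(int \<Rightarrow> complex) \<Rightarrow> int \<Rightarrow> complex" where
  "jac F n = (flux F n - flux F (n + 1)) / of_real (W n) + of_real \<mu> * F n"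

text \<open>The sesquilinear discrete Wronskian, written through the flux so that its limit at the
  origin can be read off from the boundary values.\<close>

definition casoratian :: "(int \<Rightarrow> complex) \<Rightarrow> (int \<Rightarrow> complex) \<Rightarrow> int \<Rightarrow> complex" where
  "casoratian F G n = flux F n * cnj (G n) - F n * cnj (flux G n)"

section \<open>Weighted square-summable sequences\<close>

lemma ell2_pairing_abs_summable:
  assumes "F \<in> ell2" "G \<in> ell2"
  shows "(\<lambda>n. norm (F n * cnj (G n) * of_real (W n))) summable_on UNIV"
proof (rule summable_on_comparison_test)
  show "(\<lambda>n. (norm (F n))\<^sup>2 * W n + (norm (G n))\<^sup>2 * W n) summable_on UNIV"
    using assms by (intro summable_on_add) (auto simp: ell2_def)
  fix n :: int
  have "norm (F n) * norm (G n) \<le> (norm (F n))\<^sup>2 + (norm (G n))\<^sup>2"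
    using sum_squares_bound[of "norm (F n)" "norm (G n)"]
      mult_nonneg_nonneg[OF norm_ge_zero[of "F n"] norm_ge_zero[of "G n"]] by linarith
  then have "norm (F n) * norm (G n) * W n \<le> ((norm (F n))\<^sup>2 + (norm (G n))\<^sup>2) * W n"
    using W_pos[of n] by (intro mult_right_mono) auto
  then show "norm (F n * cnj (G n) * of_real (W n)) \<le> (norm (F n))\<^sup>2 * W n + (norm (G n))\<^sup>2 * W n"
    using W_pos[of n] by (simp add: norm_mult algebra_simps)
qed auto

lemma ell2_pairing_summable:
  assumes "F \<in> ell2" "G \<in> ell2"
  shows "(\<lambda>n. F n * cnj (G n) * of_real (W n)) summable_on UNIV"
  using ell2_pairing_abs_summable[OF assms] by (rule Infinite_Sum.abs_summable_summable)

lemma ell2_lincomb: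
  assumes "F \<in> ell2" "G \<in> ell2"
  shows "(\<lambda>n. r * F n + t * G n) \<in> ell2"
proof -
  have "(\<lambda>n. 2 * (norm r)\<^sup>2 * ((norm (F n))\<^sup>2 * W n) + 2 * (norm t)\<^sup>2 * ((norm (G n))\<^sup>2 * W n)) summable_on UNIV"
    using assms by (intro summable_on_add summable_on_cmult_right) (auto simp: ell2_def)
  then show ?thesis unfolding ell2_def mem_Collect_eq
  proof (rule summable_on_comparison_test)
    fix n :: int
    have "norm (r * F n + t * G n) \<le> norm r * norm (F n) + norm t * norm (G n)"
      by (metis norm_mult norm_triangle_ineq)
    then have "(norm (r * F n + t * G n))\<^sup>2 \<le> (norm r * norm (F n) + norm t * norm (G n))\<^sup>2"
      by (intro power_mono) auto
    also have "\<dots> \<le> 2 * (norm r)\<^sup>2 * (norm (F n))\<^sup>2 + 2 * (norm t)\<^sup>2 * (norm (G n))\<^sup>2"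
      using sum_squares_bound[of "norm r * norm (F n)" "norm t * norm (G n)"]
      by (simp add: power2_sum power_mult_distrib)
    finally show "(norm (r * F n + t * G n))\<^sup>2 * W n \<le>
       2 * (norm r)\<^sup>2 * ((norm (F n))\<^sup>2 * W n) + 2 * (norm t)\<^sup>2 * ((norm (G n))\<^sup>2 * W n)"
      using W_pos[of n] mult_right_mono[of "(norm (r * F n + t * G n))\<^sup>2" _ "W n"]
      by (fastforce simp: algebra_simps)
    show "0 \<le> (norm (r * F n + t * G n))\<^sup>2 * W n" using W_pos[of n] by simp
  qed
qed

lemma ell2_finite_support:
  assumes "finite {n. F n \<noteq> 0}"
  shows "F \<in> ell2"
proof -
  have "(\<lambda>n. (norm (F n))\<^sup>2 * W n) summable_on {n. F n \<noteq> 0}"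
    using assms by (rule summable_on_finite)
  then show ?thesis unfolding ell2_def mem_Collect_eq
    by (rule summable_on_cong_neutral[THEN iffD1, rotated -1]) auto
qed

lemma summable_W_halfline: "W summable_on {0..}"
proof -
  have "(\<lambda>k. W (int k)) summable_on UNIV"
    using W_summable W_pos by (intro norm_summable_imp_summable_on) (simp add: less_imp_le)
  then have "(W \<circ> int) summable_on UNIV" by (simp add: o_def)
  then have "W summable_on (range int)"
    by (subst summable_on_reindex) auto
  also have "range int = {0..}"
    by (auto simp: image_iff) (metis nonneg_int_cases)
  finally show ?thesis .
qed

lemma ell2_bounded_halfline:
  assumes "\<And>n. n \<ge> 0 \<Longrightarrow> norm (F n) \<le> M" and "\<And>n. n < 0 \<Longrightarrow> F n = 0"
  shows "F \<in> ell2"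
proof -
  have "(\<lambda>n. M\<^sup>2 * W n) summable_on {0..}"
    by (intro summable_on_cmult_right summable_W_halfline)
  then have "(\<lambda>n. (norm (F n))\<^sup>2 * W n) summable_on {0..}"
    using assms W_pos
    by (elim summable_on_comparison_test) (auto intro!: mult_right_mono power_mono simp: less_imp_le)
  then show ?thesis unfolding ell2_def mem_Collect_eq
    by (rule summable_on_cong_neutral[THEN iffD1, rotated -1]) (auto simp: assms)
qed

text \<open>The indicator of the nonnegative integers lies in \<open>ell2\<close> because
  \<open>W\<close> is summable there, and pairing with it turns square summability into summability
  against \<open>W\<close>.\<close>

lemma ell2_imp_summable_nat:
  assumes "F \<in> ell2"
  shows "summable (\<lambda>k. F (int k) * of_real (W (int k)))"
proof -
  let ?G = "\<lambda>n::int. if n \<ge> 0 then 1 else (0::complex)"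
  have "?G \<in> ell2" by (rule ell2_bounded_halfline[where M = 1]) auto
  from ell2_pairing_summable[OF assms this]
  have "(\<lambda>n. F n * cnj (?G n) * of_real (W n)) summable_on (range int)"
    by (rule summable_on_subset_banach) auto
  then have "((\<lambda>n. F n * cnj (?G n) * of_real (W n)) \<circ> int) summable_on UNIV"
    by (subst (asm) summable_on_reindex) auto
  then have "summable ((\<lambda>n. F n * cnj (?G n) * of_real (W n)) \<circ> int)"
    by (rule summable_on_imp_summable)
  then show ?thesis by (simp add: o_def)
qed

section \<open>Boundary values at the origin\<close>

lemma (in -) convergent_of_summable_differences:
  fixes X :: "nat \<Rightarrow> complex"
  assumes "summable (\<lambda>k. X k - X (Suc k))"
  shows "convergent X"
proof -
  have "convergent (\<lambda>n. \<Sum>k<n. X k - X (Suc k))"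
    using assms by (simp add: summable_iff_convergent)
  then have "convergent (\<lambda>n. X 0 - (\<Sum>k<n. X k - X (Suc k)))"
    by (intro convergent_diff convergent_const)
  moreover have "X 0 - (\<Sum>k<n. X k - X (Suc k)) = X n" for n
    by (simp add: sum_lessThan_telescope')
  ultimately show ?thesis by simp
qed

text \<open>The increments of the flux are \<open>(jac F - \<mu> F) W\<close>, and a square-summable
  sequence is summable against \<open>W\<close> on the half line.\<close>

lemma flux_convergent:
  assumes "F \<in> ell2" "jac F \<in> ell2"
  shows "convergent (\<lambda>k. flux F (int k))"
proof (rule convergent_of_summable_differences)
  have "(\<lambda>n. 1 * jac F n + (- of_real \<mu>) * F n) \<in> ell2"
    using assms by (intro ell2_lincomb) auto
  from ell2_imp_summable_nat[OF this]
  show "summable (\<lambda>k. flux F (int k) - flux F (int (Suc k)))"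
    using W_pos by (simp add: jac_def less_imp_neq[THEN not_sym] add.commute)
qed

text \<open>The flux converges, hence is bounded by some \<open>M\<close>; dividing by
  \<open>p\<close> bounds the increments of \<open>F\<close> by \<open>M / p\<close>, which is
  summable.\<close>

lemma value_convergent:
  assumes "F \<in> ell2" "jac F \<in> ell2"
  shows "convergent (\<lambda>k. F (int k))"
proof -
  have "Bseq (\<lambda>k. flux F (int k))"
    using flux_convergent[OF assms] by (rule convergent_imp_Bseq)
  then obtain M where M: "\<And>k. norm (flux F (int k)) \<le> M" by (metis BseqE)
  have "summable (\<lambda>k. F (int k) - F (int (Suc k)))"
  proof (rule summable_comparison_test)
    show "summable (\<lambda>k. M * (1 / p (int (Suc k))))"
      using p_summable by (subst summable_Suc_iff, intro summable_mult) auto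
    have "norm (F (int k) - F (int (Suc k))) \<le> M * (1 / p (int (Suc k)))" for k
    proof -
      have "norm (flux F (int (Suc k))) = p (int (Suc k)) * norm (F (int k) - F (int (Suc k)))"
        using p_pos[of "1 + int k"] by (simp add: flux_def norm_mult)
      then show ?thesis using M[of "Suc k"] p_pos[of "int (Suc k)"] by (simp add: field_simps)
    qed
    then show "\<exists>N. \<forall>n\<ge>N. norm (F (int n) - F (int (Suc n))) \<le> M * (1 / p (int (Suc n)))" by blast
  qed
  then show ?thesis by (rule convergent_of_summable_differences)
qed

section \<open>Green's formula\<close>

lemma casoratian_diff:
  "jac F n * cnj (G n) * of_real (W n) - F n * cnj (jac G n) * of_real (W n)
     = casoratian F G n - casoratian F G (n + 1)"
proof -
  have "jac F n * of_real (W n) = flux F n - flux F (n + 1) + of_real (\<mu> * W n) * F n" for F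
    using W_pos[of n] by (simp add: jac_def field_simps)
  note J = this
  \<comment> \<open>As \<open>\<mu>\<close> and \<open>W\<close> are real, conjugation leaves the
    coefficients unchanged and the \<open>\<mu>\<close> terms of \<open>F\<close> and
    \<open>G\<close> cancel.\<close>
  have cJ: "cnj (jac G n) * of_real (W n) = cnj (flux G n) - cnj (flux G (n + 1)) + of_real (\<mu> * W n) * cnj (G n)"
    using arg_cong[OF J[of G], of cnj] by simp
  have "jac F n * cnj (G n) * of_real (W n) - F n * cnj (jac G n) * of_real (W n)
      = (jac F n * of_real (W n)) * cnj (G n) - F n * (cnj (jac G n) * of_real (W n))"
    by (simp add: algebra_simps)
  also have "\<dots> = casoratian F G n - casoratian F G (n + 1)"
    unfolding J cJ by (simp add: casoratian_def flux_def algebra_simps)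
  finally show ?thesis .
qed

lemma ell2_term_tendsto_bot:
  assumes "F \<in> ell2"
  shows "(\<lambda>k. (norm (F (- int k)))\<^sup>2 * W (- int k)) \<longlonglongrightarrow> 0"
proof -
  have "(\<lambda>n. (norm (F n))\<^sup>2 * W n) summable_on (range (\<lambda>k. - int k))"
    using assms unfolding ell2_def mem_Collect_eq by (rule summable_on_subset_banach) auto
  then have "((\<lambda>n. (norm (F n))\<^sup>2 * W n) \<circ> (\<lambda>k. - int k)) summable_on UNIV"
    by (subst (asm) summable_on_reindex) (auto simp: inj_on_def)
  then have "summable ((\<lambda>n. (norm (F n))\<^sup>2 * W n) \<circ> (\<lambda>k. - int k))"
    by (rule summable_on_imp_summable)
  then show ?thesis using summable_LIMSEQ_zero by (fastforce simp: o_def)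
qed

text \<open>Once the diagonal products cancel, only products of neighbouring entries remain.
  Splitting them into squares, \<open>p_le\<close> controls the squares at \<open>n\<close> and
  \<open>p_le'\<close> those at \<open>n - 1\<close>, each by the mass at its own index, and these
  masses tend to 0.\<close>

lemma casoratian_tendsto_bot:
  assumes F: "F \<in> ell2" and G: "G \<in> ell2"
  shows "(\<lambda>k. casoratian F G (- int k)) \<longlonglongrightarrow> 0"
proof -
  define u where "u H k = (norm (H (- int k)))\<^sup>2 * W (- int k)" for H :: "int \<Rightarrow> complex" and k
  have u0: "u H \<longlonglongrightarrow> 0" if "H \<in> ell2" for H
    using ell2_term_tendsto_bot[OF that] by (simp add: u_def[abs_def])
  note u1 = LIMSEQ_Suc[OF u0]
  have lim: "(\<lambda>k. K * (u F k + u G k + u F (Suc k) + u G (Suc k))) \<longlonglongrightarrow> 0"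
    using tendsto_mult[OF tendsto_const tendsto_add[OF tendsto_add[OF tendsto_add[OF u0[OF F] u0[OF G]] u1[OF F]] u1[OF G]], of K]
    by simp
  have le: "norm (casoratian F G (- int k)) \<le> K * (u F k + u G k + u F (Suc k) + u G (Suc k))" for k
  proof -
    define n where "n = - int k"
    have n1: "- int (Suc k) = n - 1" by (simp add: n_def)
    have cas: "casoratian F G n = of_real (p n) * (F (n - 1) * cnj (G n) - F n * cnj (G (n - 1)))"
      by (simp add: casoratian_def flux_def algebra_simps)
    have "norm (F (n - 1) * cnj (G n) - F n * cnj (G (n - 1)))
        \<le> norm (F (n - 1)) * norm (G n) + norm (F n) * norm (G (n - 1))"
      by (metis complex_mod_cnj norm_mult norm_triangle_ineq4)
    also have "\<dots> \<le> ((norm (F (n-1)))\<^sup>2 + (norm (G n))\<^sup>2) + ((norm (F n))\<^sup>2 + (norm (G (n-1)))\<^sup>2)"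
    proof -
      have *: "x * y \<le> x\<^sup>2 + y\<^sup>2" if "x \<ge> 0" "y \<ge> 0" for x y :: real
        using sum_squares_bound[of x y] mult_nonneg_nonneg[OF that] by linarith
      show ?thesis by (intro add_mono *) auto
    qed
    finally have "norm (casoratian F G n) \<le>
        p n * (((norm (F (n-1)))\<^sup>2 + (norm (G n))\<^sup>2) + ((norm (F n))\<^sup>2 + (norm (G (n-1)))\<^sup>2))"
      unfolding cas using p_pos[of n] by (simp add: norm_mult)
    also have "\<dots> = p n * (norm (F (n-1)))\<^sup>2 + p n * (norm (G n))\<^sup>2 + p n * (norm (F n))\<^sup>2 + p n * (norm (G (n-1)))\<^sup>2"
      by (simp add: algebra_simps)
    also have "\<dots> \<le> K * W (n-1) * (norm (F (n-1)))\<^sup>2 + K * W n * (norm (G n))\<^sup>2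
        + K * W n * (norm (F n))\<^sup>2 + K * W (n-1) * (norm (G (n-1)))\<^sup>2"
      using p_le[of n] p_le'[of "n - 1"] by (intro add_mono mult_right_mono) (auto simp: n_def)
    finally show ?thesis by (simp add: u_def n1 flip: n_def) (simp add: algebra_simps)
  qed
  show ?thesis by (rule Lim_null_comparison[OF _ lim]) (use le in auto)
qed

text \<open>Lets an unconditional sum over the integers be evaluated along symmetric intervals,
  where it telescopes.\<close>

lemma filterlim_int_interval: "filterlim (\<lambda>N. {- int N..int N}) (finite_subsets_at_top UNIV) sequentially"
proof (unfold filterlim_finite_subsets_at_top, intro allI impI, elim conjE)
  fix X :: "int set" assume fin: "finite X"
  define M where "M = Max (insert 0 (abs ` X))"
  have M: "\<bar>x\<bar> \<le> M" if "x \<in> X" for x using fin that unfolding M_def by (intro Max_ge) auto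
  show "\<forall>\<^sub>F N in sequentially. finite {- int N..int N} \<and> X \<subseteq> {- int N..int N} \<and> {- int N..int N} \<subseteq> UNIV"
    using eventually_ge_at_top[of "nat M"]
  proof eventually_elim
    case (elim N)
    then have "M \<le> int N" by linarith
    with M show ?case by (force simp: abs_le_iff)
  qed
qed

lemma sum_telescope_int:
  fixes c :: "int \<Rightarrow> complex"
  shows "(\<Sum>n\<in>{- int N..int N}. c n - c (n + 1)) = c (- int N) - c (int N + 1)"
proof (induction N)
  case (Suc N)
  have *: "{- int (Suc N)..int (Suc N)} = insert (- int (Suc N)) (insert (int (Suc N)) {- int N..int N})" by auto
  show ?case unfolding * using Suc by (simp add: algebra_simps)
qed auto

text \<open>The summed Lagrange identity telescopes. The lower end contributes nothing, and the
  upper end, which is the origin, enters with a minus sign.\<close>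

lemma green_formula:
  assumes F: "F \<in> ell2" "jac F \<in> ell2" and G: "G \<in> ell2" "jac G \<in> ell2"
    and "(\<lambda>k. F (int k)) \<longlonglongrightarrow> F0" "(\<lambda>k. flux F (int k)) \<longlonglongrightarrow> F1"
    and "(\<lambda>k. G (int k)) \<longlonglongrightarrow> G0" "(\<lambda>k. flux G (int k)) \<longlonglongrightarrow> G1"
  shows "pairing (jac F) G - pairing F (jac G) = F0 * cnj G1 - F1 * cnj G0"
proof -
  let ?t = "\<lambda>n. jac F n * cnj (G n) * of_real (W n) - F n * cnj (jac G n) * of_real (W n)"
  have h: "((\<lambda>n. jac F n * cnj (G n) * of_real (W n)) has_sum pairing (jac F) G) UNIV"
       "((\<lambda>n. F n * cnj (jac G n) * of_real (W n)) has_sum pairing F (jac G)) UNIV"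
    using ell2_pairing_summable[OF F(2) G(1)] ell2_pairing_summable[OF F(1) G(2)] by (simp_all add: pairing_def)
  from has_sum_add[OF h(1) has_sum_uminusI[OF h(2)]]
  have "(?t has_sum (pairing (jac F) G - pairing F (jac G))) UNIV" by simp
  then have "(sum ?t \<longlongrightarrow> (pairing (jac F) G - pairing F (jac G))) (finite_subsets_at_top UNIV)"
    by (simp add: has_sum_def)
  then have lim1: "(\<lambda>N. sum ?t {- int N..int N}) \<longlonglongrightarrow> (pairing (jac F) G - pairing F (jac G))"
    by (rule filterlim_compose[OF _ filterlim_int_interval])
  have eq: "sum ?t {- int N..int N} = casoratian F G (- int N) - casoratian F G (int (Suc N))" for N
    unfolding casoratian_diff sum_telescope_int by (simp add: add.commute)
  have "(\<lambda>k. casoratian F G (int k)) \<longlonglongrightarrow> F1 * cnj G0 - F0 * cnj G1"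
    unfolding casoratian_def using assms by (intro tendsto_intros)
  from tendsto_diff[OF casoratian_tendsto_bot[OF F(1) G(1)] LIMSEQ_Suc[OF this]]
  have "(\<lambda>N. sum ?t {- int N..int N}) \<longlonglongrightarrow> 0 - (F1 * cnj G0 - F0 * cnj G1)"
    unfolding eq .
  from LIMSEQ_unique[OF lim1 this] show ?thesis by simp
qed

section \<open>Test sequences\<close>

definition point :: "int \<Rightarrow> int \<Rightarrow> complex" where
  "point m n = (if n = m then 1 else 0)"

lemma finite_support_point: "finite {n. point m n \<noteq> 0}"
  by (simp add: point_def)

lemma finite_support_flux:
  assumes "finite {n. F n \<noteq> 0}"
  shows "finite {n. flux F n \<noteq> 0}"
proof -
  have "{n. flux F n \<noteq> 0} \<subseteq> {n. F n \<noteq> 0} \<union> (\<lambda>n. n + 1) ` {n. F n \<noteq> 0}"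
    by (auto simp: flux_def image_iff) (metis diff_add_cancel)
  then show ?thesis using assms by (metis finite_UnI finite_imageI finite_subset)
qed

lemma finite_support_jac:
  assumes "finite {n. F n \<noteq> 0}"
  shows "finite {n. jac F n \<noteq> 0}"
proof -
  have "{n. jac F n \<noteq> 0} \<subseteq> {n. F n \<noteq> 0} \<union> {n. flux F n \<noteq> 0} \<union> (\<lambda>n. n - 1) ` {n. flux F n \<noteq> 0}"
    by (auto simp: jac_def image_iff) (metis add_diff_cancel_right')
  then show ?thesis using assms finite_support_flux[OF assms] by (metis finite_UnI finite_imageI finite_subset)
qed

lemma pairing_point_left: "pairing (point m) G = cnj (G m) * of_real (W m)"
proof -
  have "pairing (point m) G = (\<Sum>\<^sub>\<infinity>n\<in>{m}. point m n * cnj (G n) * of_real (W n))"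
    unfolding pairing_def by (rule infsum_cong_neutral) (auto simp: point_def)
  then show ?thesis by (simp add: point_def)
qed

text \<open>Only the three indices around \<open>m\<close> contribute, so \<open>G\<close> may be
  arbitrary. This matters for the adjoint, where \<open>jac\<close> applied to \<open>G\<close> is
  not yet known to be square summable. The two outer terms match because both neighbours of an edge
  see the same \<open>p\<close>.\<close>

lemma pairing_jac_point: "pairing (jac (point m)) G = pairing (point m) (jac G)"
proof -
  have "pairing (jac (point m)) G = (\<Sum>\<^sub>\<infinity>n\<in>{m-1,m,m+1}. jac (point m) n * cnj (G n) * of_real (W n))"
    unfolding pairing_def by (rule infsum_cong_neutral) (auto simp: jac_def flux_def point_def)
  also have "\<dots> = cnj (jac G m) * of_real (W m)"
    using W_pos[of m] W_pos[of "m-1"] W_pos[of "m+1"]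
    by (simp add: jac_def flux_def point_def field_simps)
  finally show ?thesis by (simp add: pairing_point_left)
qed

text \<open>A cut-off constant: near the origin it solves \<open>flux F = 0\<close>, and its
  boundary data are value 1 and flux 0.\<close>

definition plateau :: "int \<Rightarrow> complex" where
  "plateau n = (if n \<ge> 0 then 1 else 0)"

text \<open>On the nonnegative integers \<open>ramp\<close> is the solution of \<open>flux F = 1\<close> vanishing at infinity.\<close>

definition ramp :: "int \<Rightarrow> complex" where
  "ramp n = (if n \<ge> 0 then of_real (\<Sum>k. 1 / p (int k + (n + 1))) else 0)"

lemma plateau_ell2: "plateau \<in> ell2"
  by (rule ell2_bounded_halfline[where M = 1]) (auto simp: plateau_def)

lemma plateau_flux: "n > 0 \<Longrightarrow> flux plateau n = 0"
  by (simp add: flux_def plateau_def)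

text \<open>The flux vanishes for negative indices and is constant for positive ones, so it can jump
  only on entering and leaving the index 0. Hence \<open>jac F\<close> differs from
  \<open>\<mu> F\<close> at most at -1 and 0, where the cut-off happens.\<close>

lemma jac_ell2I:
  assumes F: "F \<in> ell2" and c: "\<And>n. n > 0 \<Longrightarrow> flux F n = c" and z: "\<And>n. n < 0 \<Longrightarrow> F n = 0"
  shows "jac F \<in> ell2"
proof -
  let ?R = "\<lambda>n. (flux F n - flux F (n + 1)) / of_real (W n)"
  have "?R n = 0" if "n \<notin> {-1, 0}" for n
  proof (cases "n > 0")
    case True then show ?thesis using c by simp
  next
    case False with that have "n < -1" by auto
    then show ?thesis by (simp add: flux_def z)
  qed
  then have "{n. ?R n \<noteq> 0} \<subseteq> {-1, 0}" by blast
  then have "?R \<in> ell2" by (intro ell2_finite_support) (rule finite_subset, auto)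
  from ell2_lincomb[OF this F, of 1 "of_real \<mu>"] show ?thesis
    by (simp add: jac_def[abs_def])
qed

lemma plateau_jac_ell2: "jac plateau \<in> ell2"
  by (rule jac_ell2I[OF plateau_ell2, of 0]) (auto simp: plateau_flux, simp add: plateau_def)

lemma plateau_lim: "(\<lambda>k. plateau (int k)) \<longlonglongrightarrow> 1" "(\<lambda>k. flux plateau (int k)) \<longlonglongrightarrow> 0"
proof -
  show "(\<lambda>k. plateau (int k)) \<longlonglongrightarrow> 1" by (simp add: plateau_def)
  have "(\<lambda>k. flux plateau (int (Suc k))) \<longlonglongrightarrow> 0" by (simp add: plateau_flux)
  then show "(\<lambda>k. flux plateau (int k)) \<longlonglongrightarrow> 0" by (rule LIMSEQ_imp_Suc)
qed

lemma summable_p_shift: "n \<ge> 0 \<Longrightarrow> summable (\<lambda>k. 1 / p (int k + n))"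
  using summable_ignore_initial_segment[OF p_summable, of "nat n"] by simp

lemma ramp_flux:
  assumes "n > 0"
  shows "flux ramp n = 1"
proof -
  \<comment> \<open>\<open>ramp (n - 1)\<close> is the tail of the series starting at
    \<open>p n\<close>, so one step of \<open>ramp\<close> removes exactly the term
    \<open>1 / p n\<close>.\<close>
  have "(\<Sum>k. 1 / p (int k + n)) = 1 / p n + (\<Sum>k. 1 / p (int (Suc k) + n))"
    using suminf_split_head[OF summable_p_shift[of n]] assms by simp
  then have "ramp (n - 1) - ramp n = of_real (1 / p n)"
    using assms by (simp add: ramp_def algebra_simps)
  then show ?thesis using p_pos[of n] by (simp add: flux_def)
qed

lemma ramp_tendsto: "(\<lambda>k. ramp (int k)) \<longlonglongrightarrow> 0"
proof -
  have "(\<lambda>m. \<Sum>k. 1 / p (int (k + m))) \<longlonglongrightarrow> 0"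
    using p_summable by (rule suminf_exist_split2)
  from LIMSEQ_Suc[OF this] have "(\<lambda>m. complex_of_real (\<Sum>k. 1 / p (int (k + Suc m)))) \<longlonglongrightarrow> of_real 0"
    by (rule tendsto_of_real)
  then show ?thesis by (simp add: ramp_def add_ac)
qed

lemma ramp_ell2: "ramp \<in> ell2"
proof -
  have "Bseq (\<lambda>k. ramp (int k))"
    using ramp_tendsto convergentI by (blast intro: convergent_imp_Bseq)
  then obtain M where M: "\<And>k. norm (ramp (int k)) \<le> M" by (metis BseqE)
  show ?thesis
  proof (rule ell2_bounded_halfline)
    fix n :: int assume "n \<ge> 0"
    then show "norm (ramp n) \<le> M" using M[of "nat n"] by simp
  qed (simp add: ramp_def)
qed

lemma ramp_flux_lim: "(\<lambda>k. flux ramp (int k)) \<longlonglongrightarrow> 1"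
proof -
  have "(\<lambda>k. flux ramp (int (Suc k))) \<longlonglongrightarrow> 1" by (simp add: ramp_flux)
  then show ?thesis by (rule LIMSEQ_imp_Suc)
qed

text \<open>Truncation to a finite set leaves as error the tail of the norm series; the error is
  measured as a squared norm.\<close>

lemma ell2_finite_support_dense:
  assumes F: "F \<in> ell2" and e: "e > 0"
  obtains G where "finite {n. G n \<noteq> 0}"
    and "norm (pairing (\<lambda>n. F n - G n) (\<lambda>n. F n - G n)) \<le> e"
proof -
  let ?h = "\<lambda>n. F n * cnj (F n) * of_real (W n)"
  have sm: "?h summable_on UNIV" by (rule ell2_pairing_summable[OF F F])
  obtain S where S: "finite S" "dist (sum ?h S) (infsum ?h UNIV) \<le> e"
    using infsum_finite_approximation[OF sm e] by blast
  define G where "G n = (if n \<in> S then F n else 0)" for n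
  have "pairing (\<lambda>n. F n - G n) (\<lambda>n. F n - G n) = (\<Sum>\<^sub>\<infinity>n\<in>UNIV - S. ?h n)"
    unfolding pairing_def by (rule infsum_cong_neutral) (auto simp: G_def)
  also have "\<dots> = infsum ?h UNIV - sum ?h S"
    using infsum_Diff[OF sm, of S] S(1) by simp
  finally have "norm (pairing (\<lambda>n. F n - G n) (\<lambda>n. F n - G n)) \<le> e"
    using S(2) by (simp add: dist_norm norm_minus_commute)
  moreover have "finite {n. G n \<noteq> 0}"
    by (rule finite_subset[OF _ S(1)]) (auto simp: G_def)
  ultimately show thesis using that by blast
qed

lemma eventually_zero_limits:
  assumes "finite {n. F n \<noteq> 0}"
  shows "(\<lambda>k. F (int k)) \<longlonglongrightarrow> 0"
proof (rule tendsto_eventually)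
  have "finite (int -` {n. F n \<noteq> 0})" using assms by (intro finite_vimageI) auto
  then have "finite {k. F (int k) \<noteq> 0}" by (simp add: vimage_def)
  then show "\<forall>\<^sub>F k in sequentially. F (int k) = 0"
    by (simp add: eventually_cofinite flip: cofinite_eq_sequentially)
qed

end

subsection \<open>Infinite products and positivity\<close>

lemma norm_square_weighted: "u * cnj u * of_real r = of_real ((norm u)\<^sup>2 * r)"
  by (simp only: of_real_mult complex_norm_square)

lemma summable_norm_geometric:
  assumes "0 < q" "q < 1"
  shows "summable (\<lambda>k. norm (x * of_real q ^ k :: complex))"
proof -
  have "summable (\<lambda>k. norm x * q ^ k)"
    using assms by (intro summable_mult summable_geometric) auto
  then show ?thesis using assms by (simp add: norm_mult norm_power)
qed

lemma qpoch_convergent_prod: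
  assumes "0 < q" "q < 1"
  shows "convergent_prod (\<lambda>k. 1 - x * of_real q ^ k :: complex)"
proof (rule abs_convergent_prod_imp_convergent_prod)
  show "abs_convergent_prod (\<lambda>k. 1 - x * of_real q ^ k)"
    using summable_norm_geometric[OF assms, of x]
    by (simp add: abs_convergent_prod_conv_summable)
qed

lemma qpoch_LIMSEQ:
  assumes "0 < q" "q < 1"
  shows "(\<lambda>n. \<Prod>k<n. 1 - x * of_real q ^ k) \<longlonglongrightarrow> qpoch_inf q x"
proof -
  have "(\<lambda>n. \<Prod>k\<le>n. 1 - x * of_real q ^ k) \<longlonglongrightarrow> qpoch_inf q x"
    unfolding qpoch_inf_def by (rule convergent_prod_LIMSEQ[OF qpoch_convergent_prod[OF assms]])
  then show ?thesis unfolding lessThan_Suc_atMost[symmetric] by (rule LIMSEQ_imp_Suc)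
qed

lemma qpoch_nonzero:
  assumes "0 < q" "q < 1" and "\<And>k. x * of_real q ^ k \<noteq> 1"
  shows "qpoch_inf q x \<noteq> 0"
  unfolding qpoch_inf_def
  by (rule prodinf_nonzero[OF qpoch_convergent_prod[OF assms(1,2)]]) (metis assms(3) eq_iff_diff_eq_0)

lemma qpoch_split:
  assumes "0 < q" "q < 1"
  shows "qpoch_inf q x = (\<Prod>k<n. 1 - x * of_real q ^ k) * qpoch_inf q (x * of_real q ^ n)"
proof -
  have "(\<Prod>k<m+n. 1 - x * of_real q ^ k) = (\<Prod>k<n. 1 - x * of_real q ^ k) * (\<Prod>k<m. 1 - x * of_real q ^ n * of_real q ^ k)" for m
    by (induction m) (auto simp: algebra_simps power_add)
  moreover have "(\<lambda>m. \<Prod>k<m+n. 1 - x * of_real q ^ k) \<longlonglongrightarrow> qpoch_inf q x"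
    using qpoch_LIMSEQ[OF assms] by (rule LIMSEQ_ignore_initial_segment)
  moreover have "(\<lambda>m. (\<Prod>k<n. 1 - x * of_real q ^ k) * (\<Prod>k<m. 1 - x * of_real q ^ n * of_real q ^ k))
      \<longlonglongrightarrow> (\<Prod>k<n. 1 - x * of_real q ^ k) * qpoch_inf q (x * of_real q ^ n)"
    by (intro tendsto_mult tendsto_const qpoch_LIMSEQ assms)
  ultimately show ?thesis using LIMSEQ_unique by simp
qed

lemma qpoch_rec:
  assumes "0 < q" "q < 1"
  shows "qpoch_inf q x = (1 - x) * qpoch_inf q (of_real q * x)"
  using qpoch_split[OF assms, of x 1] by (simp add: mult.commute)

text \<open>The shifted product is the whole product divided by its first \<open>n\<close> factors.
  The whole product is nonzero because no factor vanishes, so the quotient tends to 1.\<close>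

lemma qpoch_tendsto_1:
  assumes "0 < q" "q < 1" and nz: "\<And>k. x * of_real q ^ k \<noteq> 1"
  shows "(\<lambda>n. qpoch_inf q (x * of_real q ^ n)) \<longlonglongrightarrow> 1"
proof -
  note nz' = qpoch_nonzero[OF assms]
  have "(\<lambda>n. qpoch_inf q x / (\<Prod>k<n. 1 - x * of_real q ^ k)) \<longlonglongrightarrow> qpoch_inf q x / qpoch_inf q x"
    by (intro tendsto_divide tendsto_const qpoch_LIMSEQ assms nz')
  moreover have "qpoch_inf q x / (\<Prod>k<n. 1 - x * of_real q ^ k) = qpoch_inf q (x * of_real q ^ n)" for n
    using qpoch_split[OF assms(1,2), of x n] nz' by (metis mult_eq_0_iff nonzero_mult_div_cancel_left)
  ultimately show ?thesis using nz' by simp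
qed

text \<open>No point of a geometric progression lies strictly between two consecutive ones. This
  serves the real parameter pairs, whose reciprocals sit inside one such gap.\<close>

lemma powi_gap:
  fixes q :: real
  assumes q: "0 < q" "q < 1" and "0 < u"
    and "u * q powi k < v" "v < w" "w < u * q powi (k - 1)"
  shows "u * q powi n < v \<or> w < u * q powi n"
proof (cases "n \<ge> k")
  case True
  then have "q powi n \<le> q powi k" using q by (intro power_int_decreasing) auto
  then have "u * q powi n \<le> u * q powi k" using \<open>0 < u\<close> by simp
  then show ?thesis using assms by linarith
next
  case False
  then have "q powi (k - 1) \<le> q powi n" using q by (intro power_int_decreasing) auto
  then have "u * q powi (k - 1) \<le> u * q powi n" using \<open>0 < u\<close> by simp
  then show ?thesis using assms by linarith
qed

text \<open>Products, coefficients and weight are built from complex parameters and only turn out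
  real. The predicate carries realness and positivity together through complex algebra.\<close>

definition pos_real :: "complex \<Rightarrow> bool" where
  "pos_real u \<longleftrightarrow> Im u = 0 \<and> Re u > 0"

lemma pos_real_of_real: "pos_real (of_real r) \<longleftrightarrow> r > 0"
  by (simp add: pos_real_def)

lemma pos_real_iff: "pos_real u \<longleftrightarrow> (\<exists>r>0. u = of_real r)"
  by (auto simp: pos_real_def complex_eq_iff intro!: exI[of _ "Re u"])

lemma pos_real_mult: "pos_real u \<Longrightarrow> pos_real v \<Longrightarrow> pos_real (u * v)"
  by (simp add: pos_real_def)

lemma pos_real_inverse: "pos_real u \<Longrightarrow> pos_real (inverse u)"
  unfolding pos_real_iff by (metis of_real_inverse positive_imp_inverse_positive)

lemma pos_real_divide: "pos_real u \<Longrightarrow> pos_real v \<Longrightarrow> pos_real (u / v)"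
  by (simp add: divide_inverse pos_real_mult pos_real_inverse)

lemma pos_real_nonzero: "pos_real u \<Longrightarrow> u \<noteq> 0"
  by (auto simp: pos_real_def)

lemma of_real_Re_pos_real: "pos_real u \<Longrightarrow> of_real (Re u) = u"
  by (simp add: pos_real_def complex_eq_iff)

lemma pos_real_prod: "(\<And>i. i \<in> I \<Longrightarrow> pos_real (f i)) \<Longrightarrow> pos_real (prod f I)"
  by (induction I rule: infinite_finite_induct) (auto simp: pos_real_mult, auto simp: pos_real_def)

lemma pos_real_limit:
  assumes "X \<longlonglongrightarrow> l" "\<And>n. pos_real (X n)" "l \<noteq> 0"
  shows "pos_real l"
proof -
  have "(\<lambda>n. Re (X n)) \<longlonglongrightarrow> Re l" "(\<lambda>n. Im (X n)) \<longlonglongrightarrow> Im l"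
    using assms(1) by (auto intro: tendsto_Re tendsto_Im)
  note lim = this
  have X: "Im (X n) = 0" "Re (X n) \<ge> 0" for n
    using assms(2)[of n] by (simp_all add: pos_real_def)
  have "Im l = 0" using lim(2) by (simp add: X LIMSEQ_const_iff)
  moreover have "Re l \<ge> 0" by (rule LIMSEQ_le_const[OF lim(1)]) (simp add: X)
  ultimately show ?thesis using assms(3) by (auto simp: pos_real_def complex_eq_iff)
qed

lemma param_pairs_not_pole:
  assumes q: "0 < q" and z: "z = zp \<or> z = zm" "zm < 0" "0 < zp"
    and "(\<alpha>, \<beta>) \<in> param_pairs q zm zp"
  shows "\<alpha> * of_real (z * q powi n) \<noteq> 1" "\<beta> * of_real (z * q powi n) \<noteq> 1"
proof -
  have *: "\<gamma> * of_real (z * q powi n) \<noteq> 1"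
    if g: "\<gamma> \<notin> of_real ` (q_half_line q (inverse zp) \<union> q_half_line q (inverse zm))" for \<gamma> :: complex
  proof
    assume "\<gamma> * of_real (z * q powi n) = 1"
    then have "\<gamma> = of_real (inverse (z * q powi n))"
      by (metis inverse_unique mult.commute of_real_inverse)
    then have "\<gamma> = of_real (inverse z * q powi (- n))"
      by (simp add: power_int_minus)
    then have "\<gamma> \<in> of_real ` (q_half_line q (inverse zp) \<union> q_half_line q (inverse zm))"
      using z(1) unfolding q_half_line_def by blast
    with g show False by contradiction
  qed
  show "\<alpha> * of_real (z * q powi n) \<noteq> 1" "\<beta> * of_real (z * q powi n) \<noteq> 1"
    by (rule *, use assms(5) in \<open>simp add: param_pairs_def\<close>)+
qed

text \<open>The parameter conditions are stated for reciprocals; factoring out \<open>r * t\<close>,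
  which is positive, passes from the reciprocals to the factors of the weight.\<close>

lemma inverse_gap_factor_pos:
  fixes r t x :: real
  assumes "r \<noteq> 0" "t \<noteq> 0" "inverse r * inverse t > 0"
    and "(inverse r - x) * (inverse t - x) > 0"
  shows "(1 - r * x) * (1 - t * x) > 0"
proof -
  have "(1 - r * x) * (1 - t * x) = (inverse r - x) * (inverse t - x) * (r * t)"
    using assms(1,2) by (simp add: field_simps)
  moreover have "r * t > 0" using assms(3) by (metis inverse_mult_distrib inverse_positive_iff_positive)
  ultimately show ?thesis using assms(4) by simp
qed

text \<open>For conjugate parameters the product is a squared modulus. For real ones both
  reciprocals lie on the same side of the node: by the gap condition if the node is on the branch
  containing the gap, by sign on the other branch.\<close>

lemma param_pairs_factor_pos:
  assumes q: "0 < q" "q < 1" and z: "z = zp \<or> z = zm" "zm < 0" "0 < zp"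
    and P: "(\<alpha>, \<beta>) \<in> param_pairs q zm zp"
  shows "pos_real ((1 - \<alpha> * of_real (z * q powi n)) * (1 - \<beta> * of_real (z * q powi n)))" (is ?A)
    and "pos_real (\<alpha> * \<beta>)" (is ?B)
proof -
  let ?x = "z * q powi n"
  have nz: "\<alpha> \<noteq> 0" "\<beta> \<noteq> 0" using P by (auto simp: param_pairs_def)
  have qn: "q powi m > 0" for m using q by (simp add: zero_less_power_int)
  have real_case: "?A \<and> ?B"
    if e: "\<alpha> = of_real r" "\<beta> = of_real t"
      and p: "inverse r * inverse t > 0" and g: "(inverse r - ?x) * (inverse t - ?x) > 0" for r t :: real
  proof -
    have rt: "r \<noteq> 0" "t \<noteq> 0" using e nz by auto
    have 1: "(1 - of_real r * of_real ?x) * (1 - of_real t * of_real ?x) = complex_of_real ((1 - r * ?x) * (1 - t * ?x))"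
      by simp
    have 2: "complex_of_real r * of_real t = of_real (r * t)" by simp
    have "r * t > 0" using p by (metis inverse_mult_distrib inverse_positive_iff_positive)
    with inverse_gap_factor_pos[OF rt p g] show ?thesis
      unfolding e 1 2 pos_real_of_real by auto
  qed
  consider (conj) "\<alpha> = cnj \<beta>"
    | (pos) r t k where "\<alpha> = of_real r" "\<beta> = of_real t" "zp * q powi k < inverse t" "inverse t < inverse r" "inverse r < zp * q powi (k - 1)"
    | (neg) r t k where "\<alpha> = of_real r" "\<beta> = of_real t" "zm * q powi (k - 1) < inverse r" "inverse r < inverse t" "inverse t < zm * q powi k"
    using P unfolding param_pairs_def by blast
  then have "?A \<and> ?B"
  proof cases
    case conj
    have *: "cnj u * u = of_real ((norm u)\<^sup>2)" for u
      by (metis complex_norm_square mult.commute)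
    have 1: "(1 - \<alpha> * of_real ?x) * (1 - \<beta> * of_real ?x) = of_real ((norm (1 - \<beta> * of_real ?x))\<^sup>2)"
      unfolding *[symmetric] conj by simp
    have 2: "\<alpha> * \<beta> = of_real ((norm \<beta>)\<^sup>2)" unfolding conj * ..
    show ?thesis unfolding 1 2 pos_real_of_real
      using nz param_pairs_not_pole(2)[OF q(1) z P, of n] by simp
  next
    case pos
    have zpk: "zp * q powi k > 0" using qn[of k] z by simp
    show ?thesis
    proof (rule real_case)
      show "inverse r * inverse t > 0" using pos(3,4) zpk by (intro mult_pos_pos) linarith+
      show "(inverse r - ?x) * (inverse t - ?x) > 0"
      proof (cases "z = zp")
        case True
        with powi_gap[OF q z(3) pos(3-5), of n]
        have "?x < inverse t \<or> inverse r < ?x" by simp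
        then show ?thesis using pos(4) by (auto simp: zero_less_mult_iff)
      next
        case False
        then have "?x < 0" using qn[of n] z by (simp add: mult_neg_pos)
        then show ?thesis using pos(3,4) zpk by (intro mult_pos_pos) linarith+
      qed
    qed (use pos in auto)
  next
    case neg
    have zmk: "zm * q powi k < 0" using qn[of k] z by (simp add: mult_neg_pos)
    show ?thesis
    proof (rule real_case)
      show "inverse r * inverse t > 0" using neg(4,5) zmk by (intro mult_neg_neg) linarith+
      show "(inverse r - ?x) * (inverse t - ?x) > 0"
      proof (cases "z = zp")
        case True
        then have "?x > 0" using qn[of n] z by simp
        then show ?thesis using neg(4,5) zmk by (intro mult_neg_neg) linarith+
      next
        case False
        then have "z = zm" using z by simp
        \<comment> \<open>Reflection at 0 turns the gap on the negative branch into one on a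
          positive progression and swaps the roles of the two reciprocals.\<close>
        with powi_gap[OF q, of "- zm" k "- inverse t" "- inverse r" n] neg(3-5) z(2)
        have "inverse t < ?x \<or> ?x < inverse r" by simp
        then show ?thesis using neg(4) by (auto simp: zero_less_mult_iff)
      qed
    qed (use neg in auto)
  qed
  then show ?A ?B by auto
qed

text \<open>The factors are positive only in pairs, so the two partial products are multiplied
  before the limit is taken. The limit stays positive because neither infinite product
  vanishes.\<close>

lemma qpoch_pair_pos:
  assumes q: "0 < q" "q < 1" and z: "z = zp \<or> z = zm" "zm < 0" "0 < zp"
    and P: "(\<alpha>, \<beta>) \<in> param_pairs q zm zp"
  shows "pos_real (qpoch_inf q (\<alpha> * of_real (z * q powi n)) * qpoch_inf q (\<beta> * of_real (z * q powi n)))"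
proof -
  let ?x = "complex_of_real (z * q powi n)"
  have sh: "?x * of_real q ^ k = of_real (z * q powi (n + int k))" for k
    using q by (simp add: power_int_add)
  have sh': "\<gamma> * ?x * of_real q ^ k = \<gamma> * of_real (z * q powi (n + int k))" for \<gamma> k
    by (simp only: mult.assoc sh[unfolded mult.assoc])
  have nz: "\<gamma> * ?x * of_real q ^ k \<noteq> 1" if "\<gamma> = \<alpha> \<or> \<gamma> = \<beta>" for \<gamma> k
    using that param_pairs_not_pole[OF q(1) z P, of "n + int k"] unfolding sh' by blast
  have pos: "pos_real ((\<Prod>k<m. 1 - \<alpha> * ?x * of_real q ^ k) * (\<Prod>k<m. 1 - \<beta> * ?x * of_real q ^ k))" for m
    unfolding prod.distrib[symmetric] sh' by (intro pos_real_prod param_pairs_factor_pos(1)[OF q z P])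
  have lim: "(\<lambda>m. (\<Prod>k<m. 1 - \<alpha> * ?x * of_real q ^ k) * (\<Prod>k<m. 1 - \<beta> * ?x * of_real q ^ k))
      \<longlonglongrightarrow> qpoch_inf q (\<alpha> * ?x) * qpoch_inf q (\<beta> * ?x)"
    by (intro tendsto_mult qpoch_LIMSEQ q)
  have "qpoch_inf q (\<gamma> * ?x) \<noteq> 0" if "\<gamma> = \<alpha> \<or> \<gamma> = \<beta>" for \<gamma>
    by (rule qpoch_nonzero[OF q nz[OF that]])
  then show ?thesis by (intro pos_real_limit[OF lim pos]) simp
qed

subsection \<open>The two branches of the q-line\<close>

locale q_params =
  fixes q zm zp :: real and a b c d :: complex
  assumes q: "0 < q" "q < 1" and zm: "zm < 0" and zp: "0 < zp"
    and ab: "(a, b) \<in> param_pairs q zm zp" and cd: "(c, d) \<in> param_pairs q zm zp"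
begin

abbreviation branch :: "real \<Rightarrow> bool" where
  "branch z \<equiv> z = zp \<or> z = zm"

definition node :: "real \<Rightarrow> int \<Rightarrow> real" where
  "node z n = z * q powi n"

abbreviation "s \<equiv> s_param q a b c d"
abbreviation "w \<equiv> weight q a b c d"
abbreviation "A \<equiv> coeff_A q a b c d"
abbreviation "B \<equiv> coeff_B q a b c d"

text \<open>The absolute value absorbs the minus sign that the Jackson integral puts on the negative
  branch, so the mass is positive on both.\<close>

definition wt :: "real \<Rightarrow> int \<Rightarrow> real" where
  "wt z n = Re (w (node z n)) * \<bar>node z n\<bar>"

definition pf :: "real \<Rightarrow> int \<Rightarrow> real" where
  "pf z n = Re (A (node z n)) * wt z n"

definition \<mu> :: real where
  "\<mu> = Re (inverse s + s)"

text \<open>Sum of triangle-inequality bounds for |A| and |B| on |x| \<ge> |z|, which is the range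
  \<open>n \<le> 0\<close>.\<close>

definition bound :: "real \<Rightarrow> real" where
  "bound z = norm (inverse s) * (1 + q / (norm a * \<bar>z\<bar>)) * (1 + q / (norm b * \<bar>z\<bar>))
     + norm s * (1 + 1 / (norm c * \<bar>z\<bar>)) * (1 + 1 / (norm d * \<bar>z\<bar>))"

text \<open>The leading coefficient of \<open>A\<close> at its double pole in 0, that is the value
  of \<open>x\<^sup>2 A(x)\<close> at the origin.\<close>

definition \<kappa> :: real where
  "\<kappa> = Re (inverse s * of_real (q\<^sup>2) / (a * b))"

lemma q_powi_pos: "q powi n > 0"
  using q by (simp add: zero_less_power_int)

lemma node_nonzero: "branch z \<Longrightarrow> node z n \<noteq> 0"
  using q zm zp by (auto simp: node_def)

lemma node_Suc: "q * node z n = node z (n + 1)"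
  using q by (simp add: node_def power_int_add)

lemma node_pred: "node z n / q = node z (n - 1)"
  using q by (simp add: node_def power_int_diff)

lemma node_int: "node z (int k) = z * q ^ k"
  by (simp add: node_def)

lemma params_nonzero: "a \<noteq> 0" "b \<noteq> 0" "c \<noteq> 0" "d \<noteq> 0"
  using ab cd by (auto simp: param_pairs_def)

section \<open>Positivity and symmetrization\<close>

lemmas ab_pos = param_pairs_factor_pos[OF q _ zm zp ab, folded node_def]
lemmas cd_pos = param_pairs_factor_pos[OF q _ zm zp cd, folded node_def]

lemma ab_product_pos: "pos_real (a * b)" and cd_product_pos: "pos_real (c * d)"
  using ab_pos(2)[of zp] cd_pos(2)[of zp] by auto

lemma s_pos: "pos_real s" and s_square: "s * s = c * d * of_real q / (a * b)"
proof -
  have "pos_real (c * d * of_real q / (a * b))"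
    using q by (intro pos_real_divide pos_real_mult[of "c * d"] ab_product_pos cd_product_pos)
      (simp add: pos_real_of_real)
  then obtain r where r: "r > 0" "c * d * of_real q / (a * b) = of_real r"
    unfolding pos_real_iff by blast
  then have "s = of_real (sqrt r)" by (simp add: s_param_def)
  with r show "pos_real s" by (simp add: pos_real_of_real)
  show "s * s = c * d * of_real q / (a * b)"
    by (simp add: s_param_def flip: power2_eq_square)
qed

lemma s_nonzero: "s \<noteq> 0"
  using s_pos by (rule pos_real_nonzero)

lemma weight_pos: "branch z \<Longrightarrow> pos_real (w (node z n))"
  unfolding weight_def node_def
  by (intro pos_real_divide qpoch_pair_pos[OF q _ zm zp ab] qpoch_pair_pos[OF q _ zm zp cd])

lemma of_real_wt: "branch z \<Longrightarrow> of_real (wt z n) = w (node z n) * of_real \<bar>node z n\<bar>"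
  by (simp add: wt_def of_real_Re_pos_real[OF weight_pos])

lemma wt_pos: "branch z \<Longrightarrow> wt z n > 0"
  using weight_pos[of z n] node_nonzero[of z n] by (simp add: wt_def pos_real_def)

text \<open>Evaluated at the next node, \<open>A\<close> acquires the factors \<open>1 - a x\<close>
  and \<open>1 - b x\<close> of the recursion of the weight at \<open>x\<close>; this is why the
  shifted form is the useful one.\<close>

lemma A_eq:
  assumes "branch z"
  shows "A (node z (n + 1)) = inverse s * ((1 - a * node z n) * (1 - b * node z n)) / (a * b * (of_real (node z n))\<^sup>2)"
  using node_nonzero[OF assms, of n] params_nonzero q s_nonzero
  unfolding coeff_A_def node_Suc[symmetric] by (simp add: field_simps power2_eq_square)

lemma B_eq:
  assumes "branch z"
  shows "B (node z n) = s * ((1 - c * node z n) * (1 - d * node z n)) / (c * d * (of_real (node z n))\<^sup>2)"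
  using node_nonzero[OF assms, of n] params_nonzero
  by (simp add: coeff_B_def field_simps power2_eq_square)

lemma A_pos:
  assumes "branch z"
  shows "pos_real (A (node z n))"
proof -
  have "pos_real (A (node z (n - 1 + 1)))"
    unfolding A_eq[OF assms]
    using assms node_nonzero[OF assms, of "n - 1"] 
    by (intro pos_real_divide pos_real_mult[of "inverse s"] pos_real_mult[of "a * b"] pos_real_inverse s_pos
          ab_pos(1) ab_product_pos) (auto simp: pos_real_of_real simp flip: of_real_power)
  then show ?thesis by simp
qed

lemma pf_pos: "branch z \<Longrightarrow> pf z n > 0"
  using A_pos[of z n] wt_pos[of z n] by (simp add: pf_def pos_real_def)

lemma of_real_pf: "branch z \<Longrightarrow> of_real (pf z n) = A (node z n) * of_real (wt z n)"
  by (simp add: pf_def of_real_Re_pos_real[OF A_pos])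

text \<open>The q-Pearson equation of the weight: each infinite product loses its first factor when
  \<open>x\<close> is replaced by \<open>q x\<close>.\<close>

lemma weight_step:
  assumes z: "branch z"
  shows "w (node z n) * ((1 - c * node z n) * (1 - d * node z n))
    = w (node z (n + 1)) * ((1 - a * node z n) * (1 - b * node z n))"
proof -
  let ?x = "complex_of_real (node z n)"
  have rec: "qpoch_inf q (u * ?x) = (1 - u * ?x) * qpoch_inf q (u * of_real (node z (n + 1)))" for u
    using qpoch_rec[OF q, of "u * ?x"] by (simp add: node_Suc[symmetric] mult_ac)
  have "1 - c * ?x \<noteq> 0" "1 - d * ?x \<noteq> 0"
    using pos_real_nonzero[OF cd_pos(1)[OF z, of n]] by auto
  then show ?thesis
    unfolding weight_def rec by (simp add: mult_ac)
qed

text \<open>The symmetry of the Jacobi matrix: the coupling from \<open>x\<close> to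
  \<open>q x\<close> through \<open>B\<close> equals that from \<open>q x\<close> to
  \<open>x\<close> through \<open>A\<close>, once each is weighted by the mass at its node.\<close>

lemma of_real_pf_Suc:
  assumes z: "branch z"
  shows "of_real (pf z (n + 1)) = B (node z n) * of_real (wt z n)"
proof -
  let ?x = "complex_of_real (node z n)"
  have abs: "\<bar>node z (n + 1)\<bar> = q * \<bar>node z n\<bar>"
    using q by (simp add: abs_mult flip: node_Suc)
  \<comment> \<open>The value of \<open>s\<close> is chosen for this balance; the factor
    \<open>q\<close> comes from the ratio of the masses |q x| and |x|.\<close>
  have s2: "inverse s * q / (a * b) = s / (c * d)"
    using s_square s_nonzero params_nonzero by (simp add: field_simps)
  have "of_real (pf z (n + 1)) = inverse s * q / (a * b) / ?x\<^sup>2 * of_real \<bar>node z n\<bar>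
       * (w (node z (n + 1)) * ((1 - a * ?x) * (1 - b * ?x)))"
    unfolding of_real_pf[OF z] of_real_wt[OF z] A_eq[OF z] abs by (simp add: field_simps)
  also have "\<dots> = s / (c * d) / ?x\<^sup>2 * of_real \<bar>node z n\<bar> * (w (node z n) * ((1 - c * ?x) * (1 - d * ?x)))"
    unfolding s2 weight_step[OF z] ..
  also have "\<dots> = B (node z n) * of_real (wt z n)"
    unfolding of_real_wt[OF z] B_eq[OF z] by (simp add: field_simps)
  finally show ?thesis .
qed

section \<open>Behaviour at the origin and at infinity\<close>

lemma node_tendsto_0: "(\<lambda>k. node z (int k)) \<longlonglongrightarrow> 0"
  unfolding node_int using q by (intro tendsto_mult_right_zero LIMSEQ_power_zero) auto

lemma weight_tendsto_1:
  assumes z: "branch z"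
  shows "(\<lambda>k. w (node z (int k))) \<longlonglongrightarrow> 1"
proof -
  have lim: "(\<lambda>k. qpoch_inf q (u * of_real (node z (int k)))) \<longlonglongrightarrow> 1"
    if "\<And>k. u * of_real (node z (int k)) \<noteq> 1" for u
  proof -
    have "u * of_real z * of_real q ^ k \<noteq> 1" for k
      using that[of k] by (simp add: node_int mult_ac)
    from qpoch_tendsto_1[OF q this] show ?thesis by (simp add: node_int mult_ac)
  qed
  note ne = param_pairs_not_pole[OF q(1) z zm zp ab, folded node_def]
    param_pairs_not_pole[OF q(1) z zm zp cd, folded node_def]
  have "(\<lambda>k. w (node z (int k))) \<longlonglongrightarrow> (1 * 1) / (1 * 1)"
    unfolding weight_def by (intro tendsto_divide tendsto_mult lim ne) simp
  then show ?thesis by simp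
qed

lemma \<kappa>_pos: "\<kappa> > 0" and of_real_\<kappa>: "of_real \<kappa> = inverse s * of_real (q\<^sup>2) / (a * b)"
proof -
  have "pos_real (inverse s * of_real (q\<^sup>2) / (a * b))"
    using q by (intro pos_real_divide pos_real_mult pos_real_inverse s_pos ab_product_pos) (simp add: pos_real_of_real del: of_real_power)
  then show "\<kappa> > 0" "of_real \<kappa> = inverse s * of_real (q\<^sup>2) / (a * b)"
    unfolding \<kappa>_def by (auto simp: pos_real_def complex_eq_iff)
qed

text \<open>One factor |x| sits in the mass and a second one is supplied here; together they cancel
  the double pole of \<open>A\<close>, and \<open>w\<close> tends to 1.\<close>

lemma pf_tendsto:
  assumes z: "branch z"
  shows "(\<lambda>k. pf z (int k) * \<bar>node z (int k)\<bar>) \<longlonglongrightarrow> \<kappa>"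
proof -
  let ?x = "\<lambda>k. complex_of_real (node z (int k))"
  have x: "?x k \<noteq> 0" for k using node_nonzero[OF z] by simp
  have "complex_of_real (pf z (int k) * \<bar>node z (int k)\<bar>)
      = inverse s * (?x k - q / a) * (?x k - q / b) * w (node z (int k))" for k
  proof -
    have sq: "complex_of_real \<bar>node z (int k)\<bar> * of_real \<bar>node z (int k)\<bar> = ?x k * ?x k"
      by (metis abs_mult_self_eq of_real_mult)
    have "complex_of_real (pf z (int k) * \<bar>node z (int k)\<bar>) = A (node z (int k)) * w (node z (int k)) * (?x k * ?x k)"
      unfolding of_real_mult of_real_pf[OF z] of_real_wt[OF z] sq[symmetric] by (simp only: mult.assoc)
    also have "\<dots> = inverse s * (?x k - q / a) * (?x k - q / b) * w (node z (int k))"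
    proof -
      have f: "?x k - q / u = (1 - of_real q / (u * ?x k)) * ?x k" if "u \<noteq> 0" for u :: complex
        using x[of k] that by (simp add: field_simps)
      show ?thesis
        unfolding coeff_A_def f[OF params_nonzero(1)] f[OF params_nonzero(2)]
        by (simp only: mult.assoc mult.left_commute mult.commute)
    qed
    finally show ?thesis .
  qed
  moreover have "?x \<longlonglongrightarrow> of_real 0" by (intro tendsto_of_real node_tendsto_0)
  then have "(\<lambda>k. inverse s * (?x k - q / a) * (?x k - q / b) * w (node z (int k)))
     \<longlonglongrightarrow> inverse s * (of_real 0 - q / a) * (of_real 0 - q / b) * 1"
    by (intro tendsto_mult tendsto_diff tendsto_const weight_tendsto_1[OF z])
  ultimately have "(\<lambda>k. complex_of_real (pf z (int k) * \<bar>node z (int k)\<bar>)) \<longlonglongrightarrow> of_real \<kappa>"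
    unfolding of_real_\<kappa> by (simp add: power2_eq_square mult.assoc)
  then show ?thesis unfolding tendsto_of_real_iff .
qed

lemma summable_node: "summable (\<lambda>k. M * \<bar>node z (int k)\<bar>)"
proof -
  have "summable (\<lambda>k. M * \<bar>z\<bar> * q ^ k)" using q by (intro summable_mult summable_geometric) auto
  then show ?thesis using q by (simp add: node_int abs_mult mult.assoc)
qed

lemma wt_summable:
  assumes z: "branch z"
  shows "summable (\<lambda>k. wt z (int k))"
proof -
  have "Bseq (\<lambda>k. w (node z (int k)))"
    by (rule convergent_imp_Bseq[OF convergentI[OF weight_tendsto_1[OF z]]])
  then obtain M where M: "\<And>k. norm (w (node z (int k))) \<le> M" by (metis BseqE)
  show ?thesis
  proof (rule summable_comparison_test'[OF summable_node])
    fix k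
    have "\<bar>Re (w (node z (int k)))\<bar> \<le> M" by (rule order_trans[OF abs_Re_le_cmod M])
    then show "norm (wt z (int k)) \<le> M * \<bar>node z (int k)\<bar>"
      unfolding wt_def real_norm_def abs_mult abs_abs by (rule mult_right_mono) simp
  qed
qed

text \<open>\<open>1 / pf\<close> is |x| times a sequence converging to \<open>1 / \<kappa>\<close>,
  hence bounded by a geometric sequence.\<close>

lemma pf_summable:
  assumes z: "branch z"
  shows "summable (\<lambda>k. 1 / pf z (int k))"
proof -
  have lim: "(\<lambda>k. 1 / (pf z (int k) * \<bar>node z (int k)\<bar>)) \<longlonglongrightarrow> 1 / \<kappa>"
    using \<kappa>_pos by (intro tendsto_divide tendsto_const pf_tendsto[OF z]) simp
  have "Bseq (\<lambda>k. 1 / (pf z (int k) * \<bar>node z (int k)\<bar>))"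
    by (rule convergent_imp_Bseq[OF convergentI[OF lim]])
  then obtain M where "0 < M" and M: "\<forall>k. norm (1 / (pf z (int k) * \<bar>node z (int k)\<bar>)) \<le> M"
    by (rule BseqE)
  show ?thesis
  proof (rule summable_comparison_test'[OF summable_node])
    fix k
    have "norm (1 / pf z (int k)) = norm (1 / (pf z (int k) * \<bar>node z (int k)\<bar>)) * \<bar>node z (int k)\<bar>"
      using node_nonzero[OF z, of "int k"] by (simp add: abs_mult)
    also have "\<dots> \<le> M * \<bar>node z (int k)\<bar>" using M by (intro mult_right_mono) auto
    finally show "norm (1 / pf z (int k)) \<le> M * \<bar>node z (int k)\<bar>" .
  qed
qed

lemma norm_factor_le:
  fixes u :: complex
  assumes z: "branch z" and n: "n \<le> 0" and "r \<ge> 0" "u \<noteq> 0"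
  shows "norm (1 - of_real r / (u * of_real (node z n))) \<le> 1 + r / (norm u * \<bar>z\<bar>)"
proof -
  have "q powi 0 \<le> q powi n" using q n by (intro power_int_decreasing) auto
  then have "1 \<le> \<bar>q powi n\<bar>" by simp
  then have "\<bar>z\<bar> \<le> \<bar>node z n\<bar>" by (simp add: node_def abs_mult mult_le_cancel_left1)
  moreover have "\<bar>z\<bar> > 0" using z zm zp by auto
  ultimately have "r / (norm u * \<bar>node z n\<bar>) \<le> r / (norm u * \<bar>z\<bar>)"
    using assms by (intro divide_left_mono mult_left_mono mult_pos_pos) auto
  then have "norm (of_real r / (u * of_real (node z n))) \<le> r / (norm u * \<bar>z\<bar>)"
    using assms by (simp add: norm_divide norm_mult)
  then show ?thesis by (intro order_trans[OF norm_triangle_ineq4]) simp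
qed

text \<open>The value of \<open>pf\<close> at \<open>n + 1\<close> is compared with the mass at
  \<open>n\<close> because it is \<open>B\<close> times that mass.\<close>

lemma bound_pf:
  assumes z: "branch z" and n: "n \<le> 0"
  shows "pf z n \<le> bound z * wt z n" and "pf z (n + 1) \<le> bound z * wt z n"
proof -
  let ?a = "norm (inverse s) * (1 + q / (norm a * \<bar>z\<bar>)) * (1 + q / (norm b * \<bar>z\<bar>))"
  let ?b = "norm s * (1 + 1 / (norm c * \<bar>z\<bar>)) * (1 + 1 / (norm d * \<bar>z\<bar>))"
  have nn: "?a \<ge> 0" "?b \<ge> 0" using q by auto
  have "norm (A (node z n)) \<le> ?a"
    unfolding coeff_A_def norm_mult using q params_nonzero
    by (intro mult_mono norm_factor_le[OF z n]) auto
  then have A: "norm (A (node z n)) \<le> bound z" using nn unfolding bound_def by linarith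
  have "norm (B (node z n)) \<le> ?b"
    unfolding coeff_B_def norm_mult using params_nonzero
    by (intro mult_mono norm_factor_le[OF z n, of 1, simplified]) auto
  then have B: "norm (B (node z n)) \<le> bound z" using nn unfolding bound_def by linarith
  have "pf z n = norm (complex_of_real (pf z n))" using pf_pos[OF z, of n] by simp
  also have "\<dots> = norm (A (node z n)) * wt z n"
    unfolding of_real_pf[OF z] using wt_pos[OF z, of n] by (simp add: norm_mult)
  also have "\<dots> \<le> bound z * wt z n" using A wt_pos[OF z, of n] by (intro mult_right_mono) auto
  finally show "pf z n \<le> bound z * wt z n" .
  have "pf z (n + 1) = norm (complex_of_real (pf z (n + 1)))" using pf_pos[OF z, of "n + 1"] by simp
  also have "\<dots> = norm (B (node z n)) * wt z n"
    unfolding of_real_pf_Suc[OF z] using wt_pos[OF z, of n] by (simp add: norm_mult)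
  also have "\<dots> \<le> bound z * wt z n" using B wt_pos[OF z, of n] by (intro mult_right_mono) auto
  finally show "pf z (n + 1) \<le> bound z * wt z n" .
qed

lemma jacobi_branch: "branch z \<Longrightarrow> jacobi (wt z) (pf z) (bound z)"
  by unfold_locales (auto intro: wt_pos pf_pos wt_summable pf_summable bound_pf)

section \<open>Transfer between the q-line and its branches\<close>

abbreviation "ell z \<equiv> jacobi.ell2 (wt z)"
abbreviation "pr z \<equiv> jacobi.pairing (wt z)"
abbreviation "fl z \<equiv> jacobi.flux (pf z)"
abbreviation "jc z \<equiv> jacobi.jac (wt z) (pf z) \<mu>"
abbreviation "H \<equiv> L2_space q zm zp a b c d"
abbreviation "ip \<equiv> L2_inner q zm zp a b c d"
abbreviation "L \<equiv> L_op q zm zp a b c d"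
abbreviation "D \<equiv> L_domain q zm zp a b c d"

definition restr :: "real \<Rightarrow> (real \<Rightarrow> complex) \<Rightarrow> int \<Rightarrow> complex" where
  "restr z f n = f (node z n)"

lemma ell_iff: "branch z \<Longrightarrow> F \<in> ell z \<longleftrightarrow> (\<lambda>n. (norm (F n))\<^sup>2 * wt z n) summable_on UNIV"
  by (simp add: jacobi.ell2_def[OF jacobi_branch])

lemma pr_eq: "branch z \<Longrightarrow> pr z F G = (\<Sum>\<^sub>\<infinity>n. F n * cnj (G n) * of_real (wt z n))"
  by (simp add: jacobi.pairing_def[OF jacobi_branch])

lemma fl_eq: "branch z \<Longrightarrow> fl z F n = of_real (pf z n) * (F (n - 1) - F n)"
  by (simp add: jacobi.flux_def[OF jacobi_branch])

lemma jc_eq: "branch z \<Longrightarrow> jc z F n = (fl z F n - fl z F (n + 1)) / of_real (wt z n) + of_real \<mu> * F n"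
  by (simp add: jacobi.jac_def[OF jacobi_branch])

lemma q_line_iff: "x \<in> q_line q zm zp \<longleftrightarrow> (\<exists>z n. branch z \<and> x = node z n)"
  by (auto simp: q_line_def q_half_line_def node_def)

lemma node_in_q_line: "branch z \<Longrightarrow> node z n \<in> q_line q zm zp"
  by (auto simp: q_line_iff)

lemma node_inj: "branch z \<Longrightarrow> branch z' \<Longrightarrow> node z n = node z' m \<longleftrightarrow> z = z' \<and> n = m"
proof (intro iffI)
  assume z: "branch z" "branch z'" and eq: "node z n = node z' m"
  have "z = z'"
  proof (rule ccontr)
    assume "z \<noteq> z'"
    then have "(z = zp \<and> z' = zm) \<or> (z = zm \<and> z' = zp)" using z by auto
    moreover have "node zp i > 0" "node zm j < 0" for i j
      using q_powi_pos zm zp by (auto simp: node_def mult_neg_pos)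
    ultimately show False using eq by (metis less_asym)
  qed
  moreover have "n = m"
  proof (rule ccontr)
    assume "n \<noteq> m"
    then have "q powi n \<noteq> q powi m"
      using power_int_strict_decreasing[of n m q] power_int_strict_decreasing[of m n q] q
      by (cases "n < m") auto
    with eq \<open>z = z'\<close> z zm zp show False by (auto simp: node_def)
  qed
  ultimately show "z = z' \<and> n = m" by simp
qed auto

text \<open>A right inverse of restriction to the branches. The chosen index pair is unique by
  \<open>node_inj\<close>, and the value 0 off the q-line follows the convention of
  \<open>L2_space\<close>.\<close>

definition glue :: "(real \<Rightarrow> int \<Rightarrow> complex) \<Rightarrow> real \<Rightarrow> complex" where
  "glue F x = (if x \<in> q_line q zm zp then (case SOME (z, n). branch z \<and> x = node z n of (z, n) \<Rightarrow> F z n) else 0)"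

lemma glue_outside: "x \<notin> q_line q zm zp \<Longrightarrow> glue F x = 0"
  by (simp add: glue_def)

lemma restr_glue: "branch z \<Longrightarrow> restr z (glue F) = F z"
proof
  fix n assume z: "branch z"
  have "(SOME p. case p of (z', n') \<Rightarrow> branch z' \<and> node z n = node z' n') = (z, n)"
  proof (rule some_equality)
    show "case (z, n) of (z', n') \<Rightarrow> branch z' \<and> node z n = node z' n'" using z by simp
    fix p assume "case p of (z', n') \<Rightarrow> branch z' \<and> node z n = node z' n'"
    then show "p = (z, n)" using node_inj[OF z] by (cases p) auto
  qed
  then show "restr z (glue F) n = F z n"
    using node_in_q_line[OF z] by (simp add: restr_def glue_def)
qed

lemma eq_of_restr:
  assumes "\<And>x. x \<notin> q_line q zm zp \<Longrightarrow> f x = g x" and "\<And>z n. branch z \<Longrightarrow> restr z f n = restr z g n"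
  shows "f = g"
proof
  fix x
  show "f x = g x"
  proof (cases "x \<in> q_line q zm zp")
    case True
    then obtain z n where "branch z" "x = node z n" unfolding q_line_iff by blast
    with assms(2)[of z n] show ?thesis by (simp add: restr_def)
  qed (rule assms(1))
qed

lemma node_zp: "zp * q powi n = \<bar>node zp n\<bar>" and node_zm: "zm * q powi n = - \<bar>node zm n\<bar>"
  using q_powi_pos[of n] zm zp by (auto simp: node_def abs_mult)

lemma jackson_term_weight:
  "jackson_term q zm zp (\<lambda>x. f x * cnj (g x) * w x) n
     = restr zp f n * cnj (restr zp g n) * of_real (wt zp n)
       + restr zm f n * cnj (restr zm g n) * of_real (wt zm n)"
proof -
  have "complex_of_real (zm * q powi n) = - of_real \<bar>node zm n\<bar>" "complex_of_real (zp * q powi n) = of_real \<bar>node zp n\<bar>"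
    unfolding node_zm node_zp by auto
  then show ?thesis
    unfolding jackson_term_def restr_def
    by (simp add: of_real_wt node_def[symmetric] mult.assoc del: of_real_mult)
qed

lemma H_iff: "f \<in> H \<longleftrightarrow> (\<forall>x. x \<notin> q_line q zm zp \<longrightarrow> f x = 0) \<and> restr zp f \<in> ell zp \<and> restr zm f \<in> ell zm"
proof -
  let ?p = "\<lambda>n. (norm (restr zp f n))\<^sup>2 * wt zp n" and ?m = "\<lambda>n. (norm (restr zm f n))\<^sup>2 * wt zm n"
  have nn: "?p n \<ge> 0" "?m n \<ge> 0" for n using wt_pos[of zp n] wt_pos[of zm n] by auto
  have "jackson_term q zm zp (\<lambda>x. f x * cnj (f x) * w x) = (\<lambda>n. of_real (?p n + ?m n))"
    unfolding jackson_term_weight norm_square_weighted by simp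
  then have "jackson_integrable q zm zp (\<lambda>x. f x * cnj (f x) * w x) \<longleftrightarrow> (\<lambda>n. complex_of_real (?p n + ?m n)) summable_on UNIV"
    by (simp add: jackson_integrable_def)
  also have "\<dots> \<longleftrightarrow> (\<lambda>n. ?p n + ?m n) summable_on UNIV"
    using summable_on_of_real summable_on_Re by fastforce
  \<comment> \<open>Both branch contributions are nonnegative, so neither can compensate the
    other.\<close>
  also have "\<dots> \<longleftrightarrow> ?p summable_on UNIV \<and> ?m summable_on UNIV"
  proof
    assume *: "(\<lambda>n. ?p n + ?m n) summable_on UNIV"
    show "?p summable_on UNIV \<and> ?m summable_on UNIV"
      using nn by (auto intro!: summable_on_comparison_test[OF *])
  qed (auto intro: summable_on_add)
  finally show ?thesis by (simp add: L2_space_def ell_iff)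
qed

lemma ip_eq:
  assumes "f \<in> H" "g \<in> H"
  shows "ip f g = of_real (1 - q) * (pr zp (restr zp f) (restr zp g) + pr zm (restr zm f) (restr zm g))"
proof -
  have "(\<Sum>\<^sub>\<infinity>n. jackson_term q zm zp (\<lambda>x. f x * cnj (g x) * w x) n)
     = pr zp (restr zp f) (restr zp g) + pr zm (restr zm f) (restr zm g)"
    unfolding jackson_term_weight pr_eq[of zp, simplified] pr_eq[of zm, simplified]
    by (intro infsum_add jacobi.ell2_pairing_summable[OF jacobi_branch])
      (use assms in \<open>auto simp: H_iff\<close>)
  then show ?thesis by (simp add: L2_inner_def jackson_integral_def)
qed

lemma of_real_\<mu>: "of_real \<mu> = inverse s + s"
  using s_pos pos_real_inverse[OF s_pos] by (simp add: \<mu>_def pos_real_def complex_eq_iff)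

text \<open>Since \<open>C = \<mu> - A - B\<close>, the operator acts through differences of
  neighbouring values, and multiplication by the mass turns \<open>A\<close> and \<open>B\<close>
  into \<open>pf\<close> at \<open>n\<close> and \<open>n + 1\<close>.\<close>

lemma restr_L:
  assumes z: "branch z"
  shows "restr z (L f) = jc z (restr z f)"
proof
  fix n
  let ?F = "restr z f"
  have W: "complex_of_real (wt z n) \<noteq> 0" using wt_pos[OF z, of n] by simp
  have "restr z (L f) n = A (node z n) * ?F (n - 1) + B (node z n) * ?F (n + 1) + coeff_C q a b c d (node z n) * ?F n"
    using node_in_q_line[OF z] by (simp add: restr_def L_op_def node_Suc node_pred)
  also have "\<dots> = A (node z n) * (?F (n - 1) - ?F n) - B (node z n) * (?F n - ?F (n + 1)) + of_real \<mu> * ?F n"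
    by (simp add: coeff_C_def of_real_\<mu> algebra_simps)
  also have "\<dots> = jc z ?F n"
    unfolding jc_eq[OF z] fl_eq[OF z] of_real_pf_Suc[OF z] of_real_pf[OF z, of n] using W
    by (simp add: field_simps)
  finally show "restr z (L f) n = jc z ?F n" .
qed

lemma L_outside: "x \<notin> q_line q zm zp \<Longrightarrow> L f x = 0"
  by (simp add: L_op_def)

text \<open>The limiting modulus of the ratio of flux and q-derivative. The division by
  \<open>q\<close> compensates that \<open>D_q\<close> is taken at node \<open>k\<close> and
  \<open>pf\<close> at node \<open>k + 1\<close>.\<close>

definition \<gamma> :: real where
  "\<gamma> = (1 - q) * \<kappa> / q"

lemma \<gamma>_pos: "\<gamma> > 0"
  using q \<kappa>_pos by (simp add: \<gamma>_def)

text \<open>Flux and q-derivative use the same difference of \<open>f\<close>, so they differ by the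
  factor \<open>?r\<close>. This factor converges to a nonzero limit, which carries convergence both
  ways; the sign of \<open>z\<close> comes from the denominator \<open>(1 - q) x\<close>.\<close>

lemma Dq_tendsto_iff:
  assumes z: "branch z"
  shows "(\<lambda>k. Dq q f (z * q ^ k)) \<longlonglongrightarrow> l \<longleftrightarrow> (\<lambda>k. fl z (restr z f) (int k)) \<longlonglongrightarrow> of_real (sgn z * \<gamma>) * l"
proof -
  let ?r = "\<lambda>k. pf z (int (Suc k)) * ((1 - q) * node z (int k))"
  have sg: "sgn z \<noteq> 0" "sgn (node z n) = sgn z" for n
    using z zm zp q q_powi_pos[of n] by (auto simp: node_def sgn_mult)
  have Suc_int: "int (Suc k) = int k + 1" for k by simp
  have r_eq: "?r k = sgn z * ((1 - q) / q) * (pf z (int (Suc k)) * \<bar>node z (int (Suc k))\<bar>)" for k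
  proof -
    have "\<bar>node z (int (Suc k))\<bar> = q * \<bar>node z (int k)\<bar>"
      unfolding Suc_int node_Suc[symmetric] using q by (simp add: abs_mult)
    then have h: "\<bar>node z (int k)\<bar> = \<bar>node z (int (Suc k))\<bar> / q"
      using q by simp
    have "node z (int k) = sgn z * (\<bar>node z (int (Suc k))\<bar> / q)"
      unfolding h[symmetric] sg(2)[of "int k", symmetric] by (rule sgn_mult_abs[symmetric])
    then show ?thesis by (simp only:) simp
  qed
  have r_lim: "?r \<longlonglongrightarrow> sgn z * \<gamma>"
    unfolding r_eq \<gamma>_def
    using tendsto_mult[OF tendsto_const LIMSEQ_Suc[OF pf_tendsto[OF z]], of "sgn z * ((1 - q) / q)"]
    by (simp add: mult.assoc)
  have r_ne: "?r k \<noteq> 0" for k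
    using pf_pos[OF z, of "int (Suc k)"] node_nonzero[OF z, of "int k"] q by auto
  \<comment> \<open>The flux looks back to \<open>n - 1\<close> while \<open>D_q\<close> looks ahead
    to \<open>q x\<close>, hence the shift by one.\<close>
  have fl_Dq: "fl z (restr z f) (int (Suc k)) = of_real (?r k) * Dq q f (z * q ^ k)" for k
    using r_ne[of k] q node_nonzero[OF z, of "int k"]
    unfolding fl_eq[OF z] Dq_def restr_def node_int[symmetric] node_Suc Suc_int
    by simp
  have lim0: "of_real (sgn z * \<gamma>) \<noteq> (0::complex)" using sg(1) \<gamma>_pos by simp
  note r_lim' = tendsto_of_real[OF r_lim, where ?'a = complex]
  show ?thesis
  proof
    assume "(\<lambda>k. Dq q f (z * q ^ k)) \<longlonglongrightarrow> l"
    from tendsto_mult[OF r_lim' this]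
    have "(\<lambda>k. fl z (restr z f) (int (Suc k))) \<longlonglongrightarrow> of_real (sgn z * \<gamma>) * l" unfolding fl_Dq .
    then show "(\<lambda>k. fl z (restr z f) (int k)) \<longlonglongrightarrow> of_real (sgn z * \<gamma>) * l" by (rule LIMSEQ_imp_Suc)
  next
    assume "(\<lambda>k. fl z (restr z f) (int k)) \<longlonglongrightarrow> of_real (sgn z * \<gamma>) * l"
    from tendsto_divide[OF LIMSEQ_Suc[OF this] r_lim' lim0]
    have "(\<lambda>k. of_real (?r k) * Dq q f (z * q ^ k) / of_real (?r k)) \<longlonglongrightarrow> l"
      unfolding fl_Dq using lim0 by simp
    moreover have "of_real (?r k) * Dq q f (z * q ^ k) / of_real (?r k) = Dq q f (z * q ^ k)" for k
      using r_ne[of k] by (metis nonzero_mult_div_cancel_left of_real_eq_0_iff)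
    ultimately show "(\<lambda>k. Dq q f (z * q ^ k)) \<longlonglongrightarrow> l" by simp
  qed
qed

text \<open>The sign change in the flux condition comes from the orientation of the negative branch.\<close>

lemma D_iff:
  "f \<in> D \<longleftrightarrow> f \<in> H \<and> L f \<in> H \<and>
     (\<exists>l. (\<lambda>k. restr zm f (int k)) \<longlonglongrightarrow> l \<and> (\<lambda>k. restr zp f (int k)) \<longlonglongrightarrow> l) \<and>
     (\<exists>l. (\<lambda>k. fl zm (restr zm f) (int k)) \<longlonglongrightarrow> - l \<and> (\<lambda>k. fl zp (restr zp f) (int k)) \<longlonglongrightarrow> l)"
proof -
  have sgn: "sgn zm = -1" "sgn zp = 1" using zm zp by auto
  have "(\<exists>l. (\<lambda>k. Dq q f (zm * q ^ k)) \<longlonglongrightarrow> l \<and> (\<lambda>k. Dq q f (zp * q ^ k)) \<longlonglongrightarrow> l)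
      \<longleftrightarrow> (\<exists>l. (\<lambda>k. fl zm (restr zm f) (int k)) \<longlonglongrightarrow> - l \<and> (\<lambda>k. fl zp (restr zp f) (int k)) \<longlonglongrightarrow> l)"
    (is "?P \<longleftrightarrow> ?Q")
  proof
    assume ?P
    then obtain l where "(\<lambda>k. Dq q f (zm * q ^ k)) \<longlonglongrightarrow> l" "(\<lambda>k. Dq q f (zp * q ^ k)) \<longlonglongrightarrow> l" by blast
    then show ?Q unfolding Dq_tendsto_iff[of zm, simplified] Dq_tendsto_iff[of zp, simplified] sgn
      by (intro exI[of _ "of_real \<gamma> * l"]) simp
  next
    assume ?Q
    then obtain l where "(\<lambda>k. fl zm (restr zm f) (int k)) \<longlonglongrightarrow> - l" "(\<lambda>k. fl zp (restr zp f) (int k)) \<longlonglongrightarrow> l" by blast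
    then show ?P unfolding Dq_tendsto_iff[of zm, simplified] Dq_tendsto_iff[of zp, simplified] sgn
      using \<gamma>_pos by (intro exI[of _ "l / of_real \<gamma>"]) simp
  qed
  then show ?thesis unfolding L_domain_def mem_Collect_eq restr_def node_int by simp
qed

section \<open>Linearity and construction of domain elements\<close>

lemma restr_lincomb: "restr z (\<lambda>x. r * f x + t * g x) = (\<lambda>n. r * restr z f n + t * restr z g n)"
  by (simp add: restr_def fun_eq_iff)

lemma H_lincomb: "f \<in> H \<Longrightarrow> g \<in> H \<Longrightarrow> (\<lambda>x. r * f x + t * g x) \<in> H"
  by (auto simp: H_iff restr_lincomb intro!: jacobi.ell2_lincomb[OF jacobi_branch])

lemma L_lincomb: "L (\<lambda>x. r * f x + t * g x) = (\<lambda>x. r * L f x + t * L g x)"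
  by (auto simp: L_op_def fun_eq_iff algebra_simps)

lemma fl_lincomb: "branch z \<Longrightarrow> fl z (\<lambda>n. r * F n + t * G n) k = r * fl z F k + t * fl z G k"
  by (simp add: fl_eq algebra_simps)

lemma D_lincomb:
  assumes f: "f \<in> D" and g: "g \<in> D"
  shows "(\<lambda>x. r * f x + t * g x) \<in> D"
proof -
  from f obtain l m where f: "f \<in> H" "L f \<in> H"
      "(\<lambda>k. restr zm f (int k)) \<longlonglongrightarrow> l" "(\<lambda>k. restr zp f (int k)) \<longlonglongrightarrow> l"
      "(\<lambda>k. fl zm (restr zm f) (int k)) \<longlonglongrightarrow> - m" "(\<lambda>k. fl zp (restr zp f) (int k)) \<longlonglongrightarrow> m"
    unfolding D_iff by blast
  from g obtain l' m' where g: "g \<in> H" "L g \<in> H"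
      "(\<lambda>k. restr zm g (int k)) \<longlonglongrightarrow> l'" "(\<lambda>k. restr zp g (int k)) \<longlonglongrightarrow> l'"
      "(\<lambda>k. fl zm (restr zm g) (int k)) \<longlonglongrightarrow> - m'" "(\<lambda>k. fl zp (restr zp g) (int k)) \<longlonglongrightarrow> m'"
    unfolding D_iff by blast
  have e: "- (r * m + t * m') = r * (- m) + t * (- m')" by simp
  show ?thesis
    unfolding D_iff L_lincomb restr_lincomb fl_lincomb[of zp, simplified] fl_lincomb[of zm, simplified]
  proof (intro conjI exI)
    show "(\<lambda>k. r * restr zm f (int k) + t * restr zm g (int k)) \<longlonglongrightarrow> r * l + t * l'"
         "(\<lambda>k. r * restr zp f (int k) + t * restr zp g (int k)) \<longlonglongrightarrow> r * l + t * l'"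
         "(\<lambda>k. r * fl zp (restr zp f) (int k) + t * fl zp (restr zp g) (int k)) \<longlonglongrightarrow> r * m + t * m'"
      by (intro tendsto_add tendsto_mult tendsto_const f g)+
    show "(\<lambda>k. r * fl zm (restr zm f) (int k) + t * fl zm (restr zm g) (int k)) \<longlonglongrightarrow> - (r * m + t * m')"
      unfolding e by (intro tendsto_add tendsto_mult tendsto_const f g)
  qed (intro H_lincomb f g)+
qed

text \<open>Here \<open>l\<close> is the common limit value and \<open>m\<close> the common
  q-derivative at 0 up to the factor \<open>\<gamma>\<close>, so elements of the domain can be
  prescribed by their boundary data.\<close>

lemma glue_in_D:
  assumes "\<And>z. branch z \<Longrightarrow> F z \<in> ell z" "\<And>z. branch z \<Longrightarrow> jc z (F z) \<in> ell z"
    and "\<And>z. branch z \<Longrightarrow> (\<lambda>k. F z (int k)) \<longlonglongrightarrow> l"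
    and "\<And>z. branch z \<Longrightarrow> (\<lambda>k. fl z (F z) (int k)) \<longlonglongrightarrow> of_real (sgn z) * m"
  shows "glue F \<in> D"
proof -
  have "sgn zm = -1" "sgn zp = 1" using zm zp by auto
  then have "(\<lambda>k. fl zm (F zm) (int k)) \<longlonglongrightarrow> - m" "(\<lambda>k. fl zp (F zp) (int k)) \<longlonglongrightarrow> m"
    using assms(4)[of zm] assms(4)[of zp] by auto
  then have "\<exists>l. (\<lambda>k. fl zm (F zm) (int k)) \<longlonglongrightarrow> - l \<and> (\<lambda>k. fl zp (F zp) (int k)) \<longlonglongrightarrow> l" by blast
  moreover have "\<exists>l. (\<lambda>k. F zm (int k)) \<longlonglongrightarrow> l \<and> (\<lambda>k. F zp (int k)) \<longlonglongrightarrow> l" using assms(3) by blast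
  ultimately show ?thesis
    unfolding D_iff H_iff using assms(1,2)
    by (simp add: restr_glue restr_L glue_outside L_outside)
qed

lemma finite_support_in_D:
  assumes fin: "\<And>z. branch z \<Longrightarrow> finite {n. F z n \<noteq> 0}"
  shows "glue F \<in> D"
proof (rule glue_in_D)
  fix z assume z: "branch z"
  show "F z \<in> ell z" by (rule jacobi.ell2_finite_support[OF jacobi_branch[OF z] fin[OF z]])
  show "jc z (F z) \<in> ell z"
    by (intro jacobi.ell2_finite_support[OF jacobi_branch[OF z]] jacobi.finite_support_jac[OF jacobi_branch[OF z]] fin z)
  show "(\<lambda>k. F z (int k)) \<longlonglongrightarrow> 0"
    by (rule jacobi.eventually_zero_limits[OF jacobi_branch[OF z] fin[OF z]])
  show "(\<lambda>k. fl z (F z) (int k)) \<longlonglongrightarrow> of_real (sgn z) * 0"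
    using jacobi.eventually_zero_limits[OF jacobi_branch[OF z] jacobi.finite_support_flux[OF jacobi_branch[OF z] fin[OF z]]]
    by simp
qed

section \<open>Symmetry and density\<close>

lemma symmetric_boundary:
  assumes f: "f \<in> H" "L f \<in> H" and g: "g \<in> H" "L g \<in> H"
    and "\<And>z. branch z \<Longrightarrow> (\<lambda>k. restr z f (int k)) \<longlonglongrightarrow> F0 z"
    and "\<And>z. branch z \<Longrightarrow> (\<lambda>k. fl z (restr z f) (int k)) \<longlonglongrightarrow> F1 z"
    and "\<And>z. branch z \<Longrightarrow> (\<lambda>k. restr z g (int k)) \<longlonglongrightarrow> G0 z"
    and "\<And>z. branch z \<Longrightarrow> (\<lambda>k. fl z (restr z g) (int k)) \<longlonglongrightarrow> G1 z"
  shows "ip (L f) g - ip f (L g) = of_real (1 - q) *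
     (F0 zp * cnj (G1 zp) - F1 zp * cnj (G0 zp) + (F0 zm * cnj (G1 zm) - F1 zm * cnj (G0 zm)))"
proof -
  have green: "pr z (jc z (restr z f)) (restr z g) - pr z (restr z f) (jc z (restr z g))
      = F0 z * cnj (G1 z) - F1 z * cnj (G0 z)" if z: "branch z" for z
    by (rule jacobi.green_formula[OF jacobi_branch[OF z]])
      (use f g z in \<open>auto simp: H_iff restr_L intro: assms\<close>)
  show ?thesis
    unfolding ip_eq[OF f(2) g(1)] ip_eq[OF f(1) g(2)] green[of zp, simplified, symmetric] green[of zm, simplified, symmetric]
    by (simp add: restr_L algebra_simps)
qed

text \<open>With equal values and opposite fluxes on the two branches, their contributions to the
  boundary form are negatives of each other.\<close>

lemma L_symmetric:
  assumes f: "f \<in> D" and g: "g \<in> D"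
  shows "ip (L f) g = ip f (L g)"
proof -
  from f obtain l m where f: "f \<in> H" "L f \<in> H"
      "(\<lambda>k. restr zm f (int k)) \<longlonglongrightarrow> l" "(\<lambda>k. restr zp f (int k)) \<longlonglongrightarrow> l"
      "(\<lambda>k. fl zm (restr zm f) (int k)) \<longlonglongrightarrow> - m" "(\<lambda>k. fl zp (restr zp f) (int k)) \<longlonglongrightarrow> m"
    unfolding D_iff by blast
  from g obtain l' m' where g: "g \<in> H" "L g \<in> H"
      "(\<lambda>k. restr zm g (int k)) \<longlonglongrightarrow> l'" "(\<lambda>k. restr zp g (int k)) \<longlonglongrightarrow> l'"
      "(\<lambda>k. fl zm (restr zm g) (int k)) \<longlonglongrightarrow> - m'" "(\<lambda>k. fl zp (restr zp g) (int k)) \<longlonglongrightarrow> m'"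
    unfolding D_iff by blast
  have ne: "zm \<noteq> zp" using zm zp by simp
  let ?F1 = "\<lambda>z. if z = zp then m else - m" and ?G1 = "\<lambda>z. if z = zp then m' else - m'"
  have "ip (L f) g - ip f (L g) = of_real (1 - q) *
      (l * cnj (?G1 zp) - ?F1 zp * cnj l' + (l * cnj (?G1 zm) - ?F1 zm * cnj l'))"
    by (rule symmetric_boundary[OF f(1,2) g(1,2)]) (use f g ne in auto)
  then have "ip (L f) g - ip f (L g) = 0" using ne by simp
  then show ?thesis by simp
qed

lemma D_dense:
  assumes f: "f \<in> H" and e: "e > 0"
  obtains g where "g \<in> D" "ip_norm ip (\<lambda>x. f x - g x) < e"
proof -
  \<comment> \<open>The pairing is a squared norm: a quarter of \<open>e\<^sup>2\<close> on each
    branch leaves at most half of it after the factor \<open>1 - q\<close>, so the final inequality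
    is strict.\<close>
  have "\<exists>G. finite {n. G n \<noteq> 0} \<and>
      norm (pr z (\<lambda>n. restr z f n - G n) (\<lambda>n. restr z f n - G n)) \<le> e\<^sup>2 / 4" if z: "branch z" for z
  proof -
    have "restr z f \<in> ell z" "e\<^sup>2 / 4 > 0" using f z e by (auto simp: H_iff)
    from jacobi.ell2_finite_support_dense[OF jacobi_branch[OF z] this] show ?thesis by blast
  qed
  then have "\<exists>G. \<forall>z. branch z \<longrightarrow> finite {n. G z n \<noteq> 0} \<and>
      norm (pr z (\<lambda>n. restr z f n - G z n) (\<lambda>n. restr z f n - G z n)) \<le> e\<^sup>2 / 4"
    by (intro choice allI) blast
  then obtain G where G: "\<And>z. branch z \<Longrightarrow> finite {n. G z n \<noteq> 0}"
    "\<And>z. branch z \<Longrightarrow> norm (pr z (\<lambda>n. restr z f n - G z n) (\<lambda>n. restr z f n - G z n)) \<le> e\<^sup>2 / 4"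
    by blast
  let ?g = "glue G" and ?u = "\<lambda>x. f x - glue G x"
  have gD: "?g \<in> D" using G(1) by (rule finite_support_in_D)
  then have "?u \<in> H" using H_lincomb[OF f, of ?g 1 "-1"] by (simp add: D_iff)
  moreover have "restr z ?u = (\<lambda>n. restr z f n - G z n)" if "branch z" for z
    using restr_glue[OF that, of G] by (auto simp: restr_def fun_eq_iff)
  ultimately have "ip ?u ?u = of_real (1 - q) * (pr zp (\<lambda>n. restr zp f n - G zp n) (\<lambda>n. restr zp f n - G zp n)
      + pr zm (\<lambda>n. restr zm f n - G zm n) (\<lambda>n. restr zm f n - G zm n))" (is "_ = _ * ?S")
    by (simp add: ip_eq)
  moreover have "norm ?S \<le> e\<^sup>2 / 4 + e\<^sup>2 / 4"
    by (intro norm_triangle_le add_mono G) auto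
  moreover have "norm (complex_of_real (1 - q)) = 1 - q" using q by (simp only: norm_of_real)
  ultimately have "norm (ip ?u ?u) \<le> (1 - q) * (e\<^sup>2 / 2)"
    using q by (simp only: norm_mult) (intro mult_left_mono, auto)
  also have "\<dots> \<le> 1 * (e\<^sup>2 / 2)" using q by (intro mult_right_mono) auto
  also have "\<dots> < e\<^sup>2" using e by simp
  finally have "Re (ip ?u ?u) < e\<^sup>2" using complex_Re_le_cmod[of "ip ?u ?u"] by linarith
  then have "ip_norm ip ?u < e"
    unfolding ip_norm_def using e by (intro real_less_lsqrt) auto
  with gD show thesis by (rule that)
qed

section \<open>The adjoint\<close>

lemma pr_zero_left: "branch z \<Longrightarrow> pr z (\<lambda>_. 0) G = 0"
  by (simp add: pr_eq)

lemma jc_zero: "branch z \<Longrightarrow> jc z (\<lambda>_. 0) = (\<lambda>_. 0)"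
  by (simp add: jc_eq fl_eq fun_eq_iff)

text \<open>A point mass at a single node lies in the domain, and testing with it reads off
  \<open>h\<close> at that node; the mass there is positive and can be cancelled.\<close>

lemma adjoint_value:
  assumes g: "g \<in> H" and h: "h \<in> H" and adj: "\<And>f. f \<in> D \<Longrightarrow> ip (L f) g = ip f h"
  shows "h = L g"
proof (rule eq_of_restr)
  fix x assume x: "x \<notin> q_line q zm zp"
  then show "h x = L g x" using h by (simp add: H_iff L_outside)
next
  fix z m assume z: "branch z"
  have ne: "zm \<noteq> zp" using zm zp by simp
  define F where "F z' = (if z' = z then jacobi.point m else (\<lambda>_. 0))" for z'
  have "glue F \<in> D"
    by (rule finite_support_in_D) (simp add: F_def jacobi.finite_support_point[OF jacobi_branch[OF z]])
  then have D: "glue F \<in> H" "L (glue F) \<in> H" "ip (L (glue F)) g = ip (glue F) h"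
    using adj by (auto simp: D_iff)
  have "pr zp (jc zp (F zp)) (restr zp g) + pr zm (jc zm (F zm)) (restr zm g)
      = pr zp (F zp) (restr zp h) + pr zm (F zm) (restr zm h)"
    using D(3) q unfolding ip_eq[OF D(2) g] ip_eq[OF D(1) h]
    by (simp add: restr_L restr_glue)
  then have "pr z (jc z (jacobi.point m)) (restr z g) = pr z (jacobi.point m) (restr z h)"
    using z ne by (auto simp: F_def pr_zero_left jc_zero)
  then have "cnj (jc z (restr z g) m) * of_real (wt z m) = cnj (restr z h m) * of_real (wt z m)"
    by (simp add: jacobi.pairing_jac_point[OF jacobi_branch[OF z]] jacobi.pairing_point_left[OF jacobi_branch[OF z]])
  then have "restr z h m = jc z (restr z g) m"
    using wt_pos[OF z, of m] by simp
  then show "restr z h m = restr z (L g) m" by (simp add: restr_L[OF z])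
qed

text \<open>As \<open>g\<close> and \<open>L g\<close> are in the space, \<open>g\<close> has a
  limit value and a limit flux on each branch. The boundary form against every domain element must
  vanish, and domain elements with boundary data (1, 0) and (0, 1) exist, which forces both gluing
  conditions on \<open>g\<close>.\<close>

lemma adjoint_domain:
  assumes g: "g \<in> H" "L g \<in> H" and adj: "\<And>f. f \<in> D \<Longrightarrow> ip (L f) g = ip f (L g)"
  shows "g \<in> D"
proof -
  have ell: "restr z g \<in> ell z" "jc z (restr z g) \<in> ell z" if "branch z" for z
    using g that by (auto simp: H_iff restr_L)
  obtain G0 where G0: "\<And>z. branch z \<Longrightarrow> (\<lambda>k. restr z g (int k)) \<longlonglongrightarrow> G0 z"
    using jacobi.value_convergent[OF jacobi_branch ell] unfolding convergent_def by metis
  obtain G1 where G1: "\<And>z. branch z \<Longrightarrow> (\<lambda>k. fl z (restr z g) (int k)) \<longlonglongrightarrow> G1 z"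
    using jacobi.flux_convergent[OF jacobi_branch ell] unfolding convergent_def by metis
  have sgn: "sgn zm = -1" "sgn zp = 1" using zm zp by auto
  have boundary: "l * cnj (G1 zp) - m * cnj (G0 zp) + (l * cnj (G1 zm) + m * cnj (G0 zm)) = 0"
    if F: "\<And>z. branch z \<Longrightarrow> F z \<in> ell z" "\<And>z. branch z \<Longrightarrow> jc z (F z) \<in> ell z"
      "\<And>z. branch z \<Longrightarrow> (\<lambda>k. F z (int k)) \<longlonglongrightarrow> l"
      "\<And>z. branch z \<Longrightarrow> (\<lambda>k. fl z (F z) (int k)) \<longlonglongrightarrow> of_real (sgn z) * m" for F l m
  proof -
    have D: "glue F \<in> D" by (rule glue_in_D[OF F])
    then have H: "glue F \<in> H" "L (glue F) \<in> H" by (auto simp: D_iff)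
    have "ip (L (glue F)) g - ip (glue F) (L g) = of_real (1 - q) *
        (l * cnj (G1 zp) - of_real (sgn zp) * m * cnj (G0 zp) + (l * cnj (G1 zm) - of_real (sgn zm) * m * cnj (G0 zm)))"
      by (rule symmetric_boundary[OF H g, where ?F0.0 = "\<lambda>_. l" and ?F1.0 = "\<lambda>z. of_real (sgn z) * m"])
        (simp_all only: restr_glue F G0 G1)
    then show ?thesis using adj[OF D] q by (simp add: sgn)
  qed
  \<comment> \<open>The plateau on both branches has common value 1 and flux 0, so only the fluxes
    of \<open>g\<close> survive.\<close>
  have "cnj (G1 zp) + cnj (G1 zm) = 0"
    using boundary[where F = "\<lambda>_. jacobi.plateau" and l = 1 and m = 0]
    by (simp add: jacobi.plateau_ell2[OF jacobi_branch] jacobi.plateau_jac_ell2[OF jacobi_branch]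
        jacobi.plateau_lim[OF jacobi_branch])
  then have flux: "G1 zm = - G1 zp"
    by (metis add.commute add_eq_0_iff complex_cnj_cnj complex_cnj_minus)
  have "- cnj (G0 zp) + cnj (G0 zm) = 0"
  proof -
    \<comment> \<open>The sign makes the fluxes of the two ramps opposite, as membership in the
      domain demands; only the limit values of \<open>g\<close> survive.\<close>
    let ?F = "\<lambda>z n. of_real (sgn z) * jacobi.ramp (pf z) n"
    have fl: "fl z (?F z) k = of_real (sgn z) * fl z (jacobi.ramp (pf z)) k" if "branch z" for z k
      using that by (simp add: fl_eq algebra_simps)
    have ell: "?F z \<in> ell z" if z: "branch z" for z
      using jacobi.ell2_lincomb[OF jacobi_branch[OF z] jacobi.ramp_ell2[OF jacobi_branch[OF z]] jacobi.ramp_ell2[OF jacobi_branch[OF z]], of "of_real (sgn z)" 0]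
      by simp
    have "0 * cnj (G1 zp) - 1 * cnj (G0 zp) + (0 * cnj (G1 zm) + 1 * cnj (G0 zm)) = 0"
    proof (rule boundary[where F = ?F])
      fix z assume z: "branch z"
      note J = jacobi_branch[OF z]
      show "?F z \<in> ell z" by (rule ell[OF z])
      show "jc z (?F z) \<in> ell z"
        by (rule jacobi.jac_ell2I[OF J ell[OF z], of "of_real (sgn z)"])
          (simp add: fl[OF z] jacobi.ramp_flux[OF J], simp add: jacobi.ramp_def[OF J])
      show "(\<lambda>k. ?F z (int k)) \<longlonglongrightarrow> 0"
        by (intro tendsto_mult_right_zero jacobi.ramp_tendsto[OF J])
      show "(\<lambda>k. fl z (?F z) (int k)) \<longlonglongrightarrow> of_real (sgn z) * 1"
        unfolding fl[OF z] by (intro tendsto_mult tendsto_const jacobi.ramp_flux_lim[OF J])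
    qed
    then show ?thesis by simp
  qed
  then have "G0 zm = G0 zp" by (simp add: complex_cnj_cancel_iff)
  then show ?thesis
    unfolding D_iff using g G0[of zp] G0[of zm] G1[of zp] G1[of zm] flux by auto
qed

lemma zero_in_D: "(\<lambda>_. 0) \<in> D"
proof -
  have "glue (\<lambda>_ _. 0) \<in> D" by (rule finite_support_in_D) simp
  also have "glue (\<lambda>_ _. 0) = (\<lambda>_. 0)" by (auto simp: glue_def fun_eq_iff split: prod.split)
  finally show ?thesis .
qed

lemma adjoint_graph_eq: "adjoint_graph H ip L D = operator_graph L D"
proof (rule set_eqI)
  fix gh :: "(real \<Rightarrow> complex) \<times> (real \<Rightarrow> complex)"
  obtain g h where gh: "gh = (g, h)" by (cases gh)
  have "gh \<in> adjoint_graph H ip L D \<longleftrightarrow> g \<in> D \<and> h = L g"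
  proof
    assume "gh \<in> adjoint_graph H ip L D"
    then have *: "g \<in> H" "h \<in> H" "\<And>f. f \<in> D \<Longrightarrow> ip (L f) g = ip f h"
      by (auto simp: adjoint_graph_def gh)
    then have "h = L g" by (rule adjoint_value)
    with * adjoint_domain[of g] show "g \<in> D \<and> h = L g" by auto
  next
    assume "g \<in> D \<and> h = L g"
    then show "gh \<in> adjoint_graph H ip L D"
      using L_symmetric by (auto simp: adjoint_graph_def gh D_iff[of g])
  qed
  then show "gh \<in> adjoint_graph H ip L D \<longleftrightarrow> gh \<in> operator_graph L D"
    by (auto simp: operator_graph_def gh)
qed

lemma L_self_adjoint: "self_adjoint_operator H ip L D"
proof -
  have "csubspace_in H D"
    using D_lincomb zero_in_D by (auto simp: csubspace_in_def D_iff[of "_::real \<Rightarrow> complex"])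
  then have "clinear_operator_on H L D"
    by (auto simp: clinear_operator_on_def L_lincomb D_iff)
  moreover have "dense_in H ip D"
    unfolding dense_in_def by (blast elim: D_dense)
  ultimately show ?thesis
    by (simp add: self_adjoint_operator_def adjoint_graph_eq)
qed

end

theorem proposition2p7:
  fixes q zm zp :: real and a b c d :: complex
  assumes "0 < q" and "q < 1" and "zm < 0" and "0 < zp"
    and "(a, b, c, d) \<in> param_set q zm zp"
  shows "self_adjoint_operator (L2_space q zm zp a b c d) (L2_inner q zm zp a b c d)
           (L_op q zm zp a b c d) (L_domain q zm zp a b c d)"
proof -
  interpret q_params q zm zp a b c d
    using assms by unfold_locales (auto simp: param_set_def)
  show ?thesis by (rule L_self_adjoint)
qed

end
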